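(* Assume that $2q\beta e^{\beta}<1$. Then there are constants $\sigma_1,\sigma_2,\sigma_3>0$ depending on $\beta$ and $q$ only such that the following hold. (1) For $N$ large enough, $\mu_N$ satisfies a logarithmic Sobolev inequality with respect to $\mathfrak{d}$: for any function $f:\{1,\dots,q\}^S\to\mathbb{R}$, $$\mathrm{Ent}_{\mu_N}(f^2)\le2\sigma_1^2\int|\mathfrak{d}f|^2\,d\mu_N.$$ (2) For $N$ large enough and any function $f:\{1,\dots,q\}^S\to\mathbb{R}$, $$\mathrm{Ent}_{\mu_N}(e^f)\le\sigma_2^2\sum_{i\in S}\int\mathrm{Cov}_{\mu_N(\cdot\mid\omega_{i^c})}\big(f(\omega_{i^c},\cdot),e^{f(\omega_{i^c},\cdot)}\big)\,d\mu_N(\omega).$$ (3) For $N$ large enough and any function $f:\{1,\dots,q\}^S\to\mathbb{R}$, $$\mathrm{Ent}_{\mu_N}(e^f)\le\frac{\sigma_3^2}{2}\int|\mathfrak{d}f|^2e^f\,d\mu_N.$$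
   Context: Block spin Potts model: for each $N$, $S=\{1,\dots,N\}$ is partitioned into $s$ blocks $S_1,\dots,S_s$ (depending on $N$; $s$ is fixed) such that the limits $\gamma_k=\lim_{N\to\infty}|S_k|/N\in(0,1)$ exist, with $\sum_{k=1}^s\gamma_k=1$. Fix an integer $q\ge3$ and reals $0<\alpha<\beta$. For $\omega\in\{1,\dots,q\}^S$, $$H_N(\omega)=-\frac{\beta}{2N}\sum_{i\sim j}\mathbf{1}_{\omega_i=\omega_j}-\frac{\alpha}{2N}\sum_{i\not\sim j}\mathbf{1}_{\omega_i=\omega_j},$$ where the sums run over ordered pairs $(i,j)\in S^2$, and $i\sim j$ means that $i,j$ lie in the same block (the case $i=j$ is included). The Gibbs measure is $\mu_N(\omega)=e^{-H_N(\omega)}/Z_N$ with $Z_N=\sum_{\omega'}e^{-H_N(\omega')}$. For $\omega\in\{1,\dots,q\}^S$ and $i\in S$, $\omega_{i^c}=(\omega_j)_{j\ne i}$, and $(\omega_{i^c},\omega_i')$ is the configuration obtained from $\omega$ by replacing $\omega_i$ with $\omega_i'$; $\mu_N(\cdot\mid\omega_{i^c})$ is the conditional distribution on $\{1,\dots,q\}$ of the $i$-th coordinate given $\omega_{i^c}$. The difference operator is $$|\mathfrak{d}f|(\omega)=\Big(\sum_{i\in S}\int\big(f(\omega)-f(\omega_{i^c},\omega_i')\big)^2\,d\mu_N(\omega_i'\mid\omega_{i^c})\Big)^{1/2}.$$ For a non-negative function $f$, $\mathrm{Ent}_{\mu_N}(f)=\int f\log f\,d\mu_N-\int f\,d\mu_N\log\big(\int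 f\,d\mu_N\big)$ (with $0\log 0=0$). $\mathrm{Cov}_\nu(a,b)=\int ab\,d\nu-\int a\,d\nu\int b\,d\nu$. *)

theory Defs
  imports "HOL-Probability.Probability"
begin

definition configs :: "nat \<Rightarrow> nat \<Rightarrow> (nat \<Rightarrow> nat) set" where
  "configs N q = {1..N} \<rightarrow>\<^sub>E {1..q}"

text \<open>\<open>B N k\<close> is the \<open>k\<close>-th block of \<open>{1..N}\<close>. Blocks may be empty
  for small \<open>N\<close> (there are not enough sites to go around); since the limiting fractions are
  positive, they are nonempty for large \<open>N\<close>.\<close>

definition block_structure :: "nat \<Rightarrow> (nat \<Rightarrow> nat \<Rightarrow> nat set) \<Rightarrow> (nat \<Rightarrow> real) \<Rightarrow> bool" where
  "block_structure s B \<gamma> \<longleftrightarrow>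
     (\<forall>N. (\<Union>k\<in>{1..s}. B N k) = {1..N} \<and> disjoint_family_on (B N) {1..s}) \<and>
     (\<forall>k\<in>{1..s}. (\<lambda>N. real (card (B N k)) / real N) \<longlonglongrightarrow> \<gamma> k \<and> 0 < \<gamma> k \<and> \<gamma> k < 1) \<and>
     (\<Sum>k=1..s. \<gamma> k) = 1"

definition same_block :: "nat \<Rightarrow> (nat \<Rightarrow> nat set) \<Rightarrow> nat \<Rightarrow> nat \<Rightarrow> bool" where
  "same_block s P i j \<longleftrightarrow> (\<exists>k\<in>{1..s}. i \<in> P k \<and> j \<in> P k)"

definition hamiltonian ::
    "real \<Rightarrow> real \<Rightarrow> nat \<Rightarrow> (nat \<Rightarrow> nat set) \<Rightarrow> nat \<Rightarrow> (nat \<Rightarrow> nat) \<Rightarrow> real" where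
  "hamiltonian \<beta> \<alpha> s P N \<omega> =
     - \<beta> / (2 * real N) *
         (\<Sum>(i, j) \<in> {(i, j) \<in> {1..N} \<times> {1..N}. same_block s P i j}. of_bool (\<omega> i = \<omega> j))
     - \<alpha> / (2 * real N) *
         (\<Sum>(i, j) \<in> {(i, j) \<in> {1..N} \<times> {1..N}. \<not> same_block s P i j}. of_bool (\<omega> i = \<omega> j))"

definition partition_fun ::
    "nat \<Rightarrow> real \<Rightarrow> real \<Rightarrow> nat \<Rightarrow> (nat \<Rightarrow> nat set) \<Rightarrow> nat \<Rightarrow> real" where
  "partition_fun q \<beta> \<alpha> s P N = (\<Sum>\<omega>\<in>configs N q. exp (- hamiltonian \<beta> \<alpha> s P N \<omega>))"

definition gibbs ::
    "nat \<Rightarrow> real \<Rightarrow> real \<Rightarrow> nat \<Rightarrow> (nat \<Rightarrow> nat set) \<Rightarrow> nat \<Rightarrow> (nat \<Rightarrow> nat) pmf" where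
  "gibbs q \<beta> \<alpha> s P N = embed_pmf (\<lambda>\<omega>.
     if \<omega> \<in> configs N q
     then exp (- hamiltonian \<beta> \<alpha> s P N \<omega>) / partition_fun q \<beta> \<alpha> s P N else 0)"

text \<open>The conditional law on single-site values of the \<open>i\<close>-th coordinate, given the
  coordinates of \<open>\<omega>\<close> in \<open>{1..N} - {i}\<close>.\<close>

definition cond_site :: "nat \<Rightarrow> (nat \<Rightarrow> nat) pmf \<Rightarrow> nat \<Rightarrow> (nat \<Rightarrow> nat) \<Rightarrow> nat pmf" where
  "cond_site N \<mu> i \<omega> =
     map_pmf (\<lambda>\<omega>'. \<omega>' i) (cond_pmf \<mu> {\<omega>'. \<forall>j\<in>{1..N} - {i}. \<omega>' j = \<omega> j})"

definition diff_op ::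
    "nat \<Rightarrow> (nat \<Rightarrow> nat) pmf \<Rightarrow> ((nat \<Rightarrow> nat) \<Rightarrow> real) \<Rightarrow> (nat \<Rightarrow> nat) \<Rightarrow> real" where
  "diff_op N \<mu> f \<omega> =
     sqrt (\<Sum>i=1..N. measure_pmf.expectation (cond_site N \<mu> i \<omega>) (\<lambda>x. (f \<omega> - f (fun_upd \<omega> i x))\<^sup>2))"

text \<open>Since \<open>ln 0 = 0\<close>, the convention \<open>0 log 0 = 0\<close> holds here.\<close>

definition Ent :: "'a pmf \<Rightarrow> ('a \<Rightarrow> real) \<Rightarrow> real" where
  "Ent \<nu> g = measure_pmf.expectation \<nu> (\<lambda>x. g x * ln (g x))
           - measure_pmf.expectation \<nu> g * ln (measure_pmf.expectation \<nu> g)"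

definition Cov :: "'a pmf \<Rightarrow> ('a \<Rightarrow> real) \<Rightarrow> ('a \<Rightarrow> real) \<Rightarrow> real" where
  "Cov \<nu> a b = measure_pmf.expectation \<nu> (\<lambda>x. a x * b x)
             - measure_pmf.expectation \<nu> a * measure_pmf.expectation \<nu> b"

text \<open>The side conditions of \<open>embed_pmf\<close> and \<open>cond_pmf\<close> are met.\<close>

lemma finite_configs: "finite (configs N q)"
  by (simp add: configs_def finite_PiE)

lemma partition_fun_pos:
  assumes "0 < q"
  shows "0 < partition_fun q \<beta> \<alpha> s P N"
proof -
  have "configs N q \<noteq> {}"
    using assms by (auto simp: configs_def PiE_eq_empty_iff)
  then show ?thesis
    unfolding partition_fun_def by (intro sum_pos finite_configs) auto
qed

lemma pmf_gibbs:
  assumes "0 < q"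
  shows "pmf (gibbs q \<beta> \<alpha> s P N) \<omega> =
    (if \<omega> \<in> configs N q
     then exp (- hamiltonian \<beta> \<alpha> s P N \<omega>) / partition_fun q \<beta> \<alpha> s P N else 0)"
  unfolding gibbs_def
proof (rule pmf_embed_pmf)
  let ?Z = "partition_fun q \<beta> \<alpha> s P N"
  let ?g = "\<lambda>\<omega>. if \<omega> \<in> configs N q then exp (- hamiltonian \<beta> \<alpha> s P N \<omega>) / ?Z else 0"
  note Z = partition_fun_pos[OF assms, of \<beta> \<alpha> s P N]
  show "0 \<le> ?g \<omega>" for \<omega>
    using Z by simp
  have "(\<integral>\<^sup>+\<omega>. ennreal (?g \<omega>) \<partial>count_space UNIV) = (\<Sum>\<omega>\<in>configs N q. ennreal (?g \<omega>))"
    by (rule nn_integral_count_space'[OF finite_configs]) auto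
  also have "\<dots> = ennreal (\<Sum>\<omega>\<in>configs N q. ?g \<omega>)"
    using Z by (intro sum_ennreal) auto
  also have "(\<Sum>\<omega>\<in>configs N q. ?g \<omega>) = 1"
    using Z by (simp add: partition_fun_def flip: sum_divide_distrib)
  finally show "(\<integral>\<^sup>+\<omega>. ennreal (?g \<omega>) \<partial>count_space UNIV) = 1"
    by simp
qed

lemma set_pmf_gibbs: "0 < q \<Longrightarrow> set_pmf (gibbs q \<beta> \<alpha> s P N) = configs N q"
  using partition_fun_pos[of q \<beta> \<alpha> s P N] by (auto simp: set_pmf_eq pmf_gibbs)

lemma cond_site_event_nonempty:
  assumes "0 < q" "\<omega> \<in> configs N q"
  shows "set_pmf (gibbs q \<beta> \<alpha> s P N) \<inter> {\<omega>'. \<forall>j\<in>{1..N} - {i}. \<omega>' j = \<omega> j} \<noteq> {}"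
  using assms by (auto simp: set_pmf_gibbs)

end

theory Submission imports Defs begin

(* The logarithmic Sobolev constant is controlled by adding one site at a time. Passing from n to
   n + 1 resampled sites, the entropy of f^2 splits into the average of the entropies on n sites
   and the entropy of x -> E_n[f^2 | x_(n+1) = x] on the single site n + 1. The latter compares two
   n-site Gibbs measures whose relative density r is Lipschitz with constants of order 1/N. The
   martingale method shows that r is subgaussian with variance of order 1/N (the influence of a
   site on the mean of a Lipschitz function stays bounded because beta is small), so the entropy
   variational principle bounds (Cov(r, f^2))^2 by E[f^2] Ent(f^2) / N up to a constant. Hence each
   site multiplies the constant by at most 1 + K/N and N sites by at most e^K. The two modified
   inequalities follow by inserting e^(f/2) and symmetrizing with the single-site resampling
   invariance of the Gibbs measure. *)

text \<open>The obstacle is a circle: concentration of r needs conditional means of bounded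
  oscillation, that oscillation is a covariance under an n-site measure, and bounding a covariance
  needs concentration again. Variances alone break it. If a function with differences at most l has
  variance at most n l^2, then its conditional means oscillate by at most 2l, and a range of 2l adds
  variance at most l^2; the bound reproduces itself without loss. This closes under N eps M^2 <= 1,
  where M = e^beta bounds the effect of one spin on the weight and eps = e^(2 beta/N) - 1 the
  interaction of two spins. The temperature assumption with q >= 3 forces beta < 1/6, whence 2 beta
  e^(4 beta) <= 1. The covariance bound carries a factor E[f^2], which an additive recursion for the
  entropy cannot absorb. Comparing square roots of the means E_n[f^2 | x] instead of the means
  themselves divides this factor out.\<close>

section \<open>Elementary real inequalities\<close>

text \<open>A cheap substitute for Hoeffding's lemma: for a centred variable the linear term
  averages to zero, leaving a subgaussian exponential moment with a non-optimal constant.\<close>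

lemma exp_le_self_plus_exp_sq: "exp t \<le> t + exp (t\<^sup>2)" for t :: real
proof -
  have quad: "1 + t\<^sup>2 \<le> exp (t\<^sup>2)"
    by (rule exp_ge_add_one_self)
  consider "t < -1" | "-1 \<le> t" "t \<le> 0" | "0 \<le> t" "t \<le> 1" | "1 < t"
    by linarith
  then show ?thesis
  proof cases
    case 1
    then have "0 \<le> t * (t + 1)"
      by (simp add: mult_nonpos_nonpos)
    then have "0 \<le> t + t\<^sup>2"
      by (simp add: power2_eq_square algebra_simps)
    moreover have "exp t \<le> 1"
      using 1 by simp
    ultimately show ?thesis
      using quad by linarith
  next
    case 2
    define s where "s = - t"
    have s: "0 \<le> s"
      using 2 by (simp add: s_def)
    \<comment> \<open>The second factor is the lower Taylor bound of e^s, so a product of at least 1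
      bounds e^(-s) by the first factor.\<close>
    have "1 \<le> (1 - s + s\<^sup>2) * (1 + s + s\<^sup>2 / 2)"
    proof -
      have "(1 - s + s\<^sup>2) * (1 + s + s\<^sup>2 / 2) = 1 + s^2/2 + s^3/2 + s^4/2"
        by (simp add: field_simps power2_eq_square power3_eq_cube power4_eq_xxxx)
      then show ?thesis
        using s by simp
    qed
    also have "\<dots> \<le> (1 - s + s\<^sup>2) * exp s"
    proof (rule mult_left_mono)
      show "1 + s + s\<^sup>2 / 2 \<le> exp s"
        using exp_lower_Taylor_quadratic[OF s] .
      have "0 \<le> (1 - s)\<^sup>2 + s"
        using s by simp
      then show "0 \<le> 1 - s + s\<^sup>2"
        by (simp add: power2_eq_square algebra_simps)
    qed
    finally have "exp t \<le> 1 - s + s\<^sup>2"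
      by (simp add: s_def exp_minus field_simps)
    then have "exp t \<le> 1 + t + t\<^sup>2"
      by (simp add: s_def)
    then show ?thesis
      using quad by linarith
  next
    case 3
    then show ?thesis
      using exp_bound[of t] quad by linarith
  next
    case 4
    then have "t \<le> t\<^sup>2"
      using mult_left_mono[of 1 t t] by (simp add: power2_eq_square)
    then have "exp t \<le> exp (t\<^sup>2)"
      by simp
    then show ?thesis
      using 4 by linarith
  qed
qed

text \<open>Inserting \<open>t = |A| / (2b)\<close> gives the optimal bound without the root
  sqrt(a/b). If b = 0, a large t forces A = 0.\<close>

lemma square_le_of_affine_bounds:
  fixes A a b :: real
  assumes "0 \<le> a" "0 \<le> b"
    and bound: "\<And>t. 0 < t \<Longrightarrow> \<bar>A\<bar> \<le> a / t + b * t"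
  shows "A\<^sup>2 \<le> 4 * a * b"
proof (cases "A = 0")
  case False
  then have A: "0 < \<bar>A\<bar>"
    by simp
  show ?thesis
  proof (cases "b = 0")
    case True
    have "\<bar>A\<bar> \<le> a / ((2 * a + 1) / \<bar>A\<bar>)"
      using bound[of "(2 * a + 1) / \<bar>A\<bar>"] A assms True by simp
    then have "\<bar>A\<bar> + a * \<bar>A\<bar> \<le> 0"
      using A assms by (simp add: field_simps)
    moreover have "0 \<le> a * \<bar>A\<bar>"
      using assms by simp
    ultimately show ?thesis
      using A by linarith
  next
    case b: False
    have "\<bar>A\<bar> \<le> a / (\<bar>A\<bar> / (2 * b)) + b * (\<bar>A\<bar> / (2 * b))"
      using bound[of "\<bar>A\<bar> / (2 * b)"] A assms b by simp
    then have "\<bar>A\<bar> * \<bar>A\<bar> \<le> 4 * a * b"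
      using A b by (simp add: field_simps)
    then show ?thesis
      by (simp add: power2_eq_square)
  qed
qed (use assms in simp)

text \<open>Since A - B = (sqrt A - sqrt B)(sqrt A + sqrt B), the second factor is at least sqrt B.
  This later cancels a factor B from a bound on (A - B)^2.\<close>

lemma sqrt_diff_sq_mult_le:
  fixes A B :: real
  assumes "0 \<le> A" "0 \<le> B"
  shows "(sqrt A - sqrt B)\<^sup>2 * B \<le> (A - B)\<^sup>2"
proof -
  have "(sqrt A - sqrt B)\<^sup>2 * B \<le> (sqrt A - sqrt B)\<^sup>2 * (sqrt A + sqrt B)\<^sup>2"
  proof (rule mult_left_mono)
    have "(sqrt B)\<^sup>2 \<le> (sqrt A + sqrt B)\<^sup>2"
      using assms by (intro power_mono) auto
    then show "B \<le> (sqrt A + sqrt B)\<^sup>2"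
      using assms by simp
  qed simp
  also have "\<dots> = (A - B)\<^sup>2"
    using assms by (simp flip: power_mult_distrib add: algebra_simps)
  finally show ?thesis .
qed

lemma exp_half_diff_le:
  assumes "b \<le> (a :: real)"
  shows "0 \<le> exp (a / 2) - exp (b / 2)" "exp (a / 2) - exp (b / 2) \<le> exp (a / 2) * ((a - b) / 2)"
proof -
  have "exp (a / 2) * (1 + (b - a) / 2) \<le> exp (a / 2) * exp ((b - a) / 2)"
    by (intro mult_left_mono exp_ge_add_one_self) simp
  also have "\<dots> = exp (b / 2)"
    by (simp add: field_simps flip: exp_add)
  finally show "exp (a / 2) - exp (b / 2) \<le> exp (a / 2) * ((a - b) / 2)"
    by (simp add: field_simps)
qed (use assms in simp)

text \<open>Convexity bounds one of the two equal factors on the left. The constant 1/2 is chosen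
  because the average of the bracket over an independent pair is twice a covariance.\<close>

lemma exp_half_diff_sq_le_covariance:
  "(exp (a / 2) - exp (b / 2))\<^sup>2 \<le> 1 / 2 * ((a - b) * (exp a - exp b))" for a b :: real
proof (induction a b rule: linorder_wlog)
  case (le b a)
  let ?A = "exp (a / 2)" and ?B = "exp (b / 2)"
  have "(?A - ?B)\<^sup>2 \<le> (?A - ?B) * (?A * ((a - b) / 2))"
    unfolding power2_eq_square using exp_half_diff_le[OF le] by (intro mult_left_mono)
  also have "\<dots> \<le> (?A - ?B) * ((?A + ?B) * ((a - b) / 2))"
    using exp_half_diff_le[OF le] le by (intro mult_left_mono mult_right_mono) auto
  also have "\<dots> = 1 / 2 * ((a - b) * (?A\<^sup>2 - ?B\<^sup>2))"
    by (simp add: power2_eq_square field_simps)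
  finally show ?case
    by (simp add: power2_commute[of ?B] algebra_simps flip: exp_double)
qed (simp add: power2_commute algebra_simps)

text \<open>Convexity gives the summand of the larger exponent alone; adding the other one makes the
  bound independent of the order of a and b.\<close>

lemma exp_half_diff_sq_le_energy:
  "(exp (a / 2) - exp (b / 2))\<^sup>2 \<le> 1 / 4 * ((a - b)\<^sup>2 * exp a + (b - a)\<^sup>2 * exp b)"
  for a b :: real
proof (induction a b rule: linorder_wlog)
  case (le b a)
  have "(exp (a / 2) - exp (b / 2))\<^sup>2 \<le> (exp (a / 2) * ((a - b) / 2))\<^sup>2"
    using exp_half_diff_le[OF le] by (intro power_mono)
  also have "\<dots> = 1 / 4 * ((a - b)\<^sup>2 * exp a)"
    by (simp add: power_mult_distrib power_divide flip: exp_double)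
  finally show ?case
    by (simp add: power2_commute[of "exp (b / 2)"] power2_commute[of b])
      (smt (verit) exp_gt_zero mult_nonneg_nonneg zero_le_power2)
qed (simp add: power2_commute algebra_simps)

section \<open>Positive normalized functionals\<close>

text \<open>One abstract expectation serves three times: for Gibbs means with frozen sites, for the
  law \<open>p\<close> of the newly added site, and for the single-site conditional laws.
  \<open>\<Omega>\<close> is only the set on which inequalities are tested.\<close>

locale positive_mean =
  fixes \<Omega> :: "'a set" and E :: "('a \<Rightarrow> real) \<Rightarrow> real"
  assumes add: "E (\<lambda>x. f x + g x) = E f + E g"
    and scale: "E (\<lambda>x. c * f x) = c * E f"
    and nonneg: "(\<And>x. x \<in> \<Omega> \<Longrightarrow> 0 \<le> f x) \<Longrightarrow> 0 \<le> E f"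
    and one: "E (\<lambda>x. 1) = 1"
begin

definition ent :: "('a \<Rightarrow> real) \<Rightarrow> real" where
  "ent F = E (\<lambda>x. F x * ln (F x)) - E F * ln (E F)"

lemma const: "E (\<lambda>x. c) = c"
  using scale[of c "\<lambda>x. 1"] one by simp

lemma scale_right: "E (\<lambda>x. f x * c) = E f * c"
  using scale[of c f] by (simp add: mult.commute)

lemma uminus: "E (\<lambda>x. - f x) = - E f"
  using scale[of "-1" f] by simp

lemma diff: "E (\<lambda>x. f x - g x) = E f - E g"
  using add[of f "\<lambda>x. - g x"] uminus[of g] by simp

lemma mono:
  assumes "\<And>x. x \<in> \<Omega> \<Longrightarrow> f x \<le> g x"
  shows "E f \<le> E g"
  using nonneg[of "\<lambda>x. g x - f x"] assms by (simp add: diff)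

lemma cauchy_schwarz: "(E (\<lambda>x. f x * g x))\<^sup>2 \<le> E (\<lambda>x. (f x)\<^sup>2) * E (\<lambda>x. (g x)\<^sup>2)"
proof -
  let ?a = "E (\<lambda>x. (f x)\<^sup>2)" and ?b = "E (\<lambda>x. f x * g x)" and ?c = "E (\<lambda>x. (g x)\<^sup>2)"
  have quad: "0 \<le> ?a - 2 * t * ?b + t\<^sup>2 * ?c" for t
  proof -
    have "0 \<le> E (\<lambda>x. (f x - t * g x)\<^sup>2)"
      by (rule nonneg) simp
    also have "(\<lambda>x. (f x - t * g x)\<^sup>2) =
        (\<lambda>x. (f x)\<^sup>2 - (2 * t) * (f x * g x) + t\<^sup>2 * (g x)\<^sup>2)"
      by (auto simp: power2_eq_square algebra_simps)
    also have "E \<dots> = ?a - 2 * t * ?b + t\<^sup>2 * ?c"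
      by (simp only: add diff scale)
    finally show ?thesis .
  qed
  have c: "0 \<le> ?c"
    by (rule nonneg) simp
  show ?thesis
  proof (cases "?c = 0")
    case True
    have "?b = 0"
    proof (rule ccontr)
      assume "?b \<noteq> 0"
      then show False
        using quad[of "(?a + 1) / (2 * ?b)"] True by simp
    qed
    then show ?thesis
      using True by simp
  next
    case False
    then show ?thesis
      using quad[of "?b / ?c"] c by (simp add: field_simps power2_eq_square)
  qed
qed

lemma covariance_eq:
  "E (\<lambda>x. f x * g x) - E f * E g = E (\<lambda>x. (f x - E f) * (g x - E g))"
proof -
  have "(\<lambda>x. (f x - E f) * (g x - E g)) =
      (\<lambda>x. (f x * g x - E g * f x) - (E f * g x - E f * E g))"
    by (auto simp: algebra_simps)
  then show ?thesis
    by (simp add: diff scale const)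
qed

lemma variance_eq: "E (\<lambda>x. (f x - E f)\<^sup>2) = E (\<lambda>x. (f x)\<^sup>2) - (E f)\<^sup>2"
  using covariance_eq[of f f] by (simp add: power2_eq_square)

lemma square_mean_le: "(E f)\<^sup>2 \<le> E (\<lambda>x. (f x)\<^sup>2)"
  using variance_eq[of f] nonneg[of "\<lambda>x. (f x - E f)\<^sup>2"] by simp

lemma variance_le: "E (\<lambda>x. (f x - E f)\<^sup>2) \<le> E (\<lambda>x. (f x - c)\<^sup>2)"
proof -
  have "(\<lambda>x. (f x - c)\<^sup>2) = (\<lambda>x. (f x)\<^sup>2 - 2 * c * f x + c\<^sup>2)"
    by (auto simp: power2_eq_square algebra_simps)
  then have "E (\<lambda>x. (f x - c)\<^sup>2) = E (\<lambda>x. (f x)\<^sup>2) - 2 * c * E f + c\<^sup>2"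
    by (simp only: add diff scale const)
  moreover have "0 \<le> (E f - c)\<^sup>2"
    by simp
  ultimately show ?thesis
    unfolding variance_eq by (simp add: power2_eq_square algebra_simps)
qed

lemma covariance_le_of_variances:
  assumes "E (\<lambda>x. (f x - E f)\<^sup>2) \<le> c * a\<^sup>2" "E (\<lambda>x. (g x - E g)\<^sup>2) \<le> c * b\<^sup>2"
    and "0 \<le> a" "0 \<le> b" "0 \<le> c"
  shows "E (\<lambda>x. f x * g x) - E f * E g \<le> c * a * b"
proof -
  have "(E (\<lambda>x. f x * g x) - E f * E g)\<^sup>2 \<le>
      E (\<lambda>x. (f x - E f)\<^sup>2) * E (\<lambda>x. (g x - E g)\<^sup>2)"
    unfolding covariance_eq by (rule cauchy_schwarz)
  also have "\<dots> \<le> (c * a\<^sup>2) * (c * b\<^sup>2)"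
    using assms by (intro mult_mono nonneg) auto
  also have "\<dots> = (c * a * b)\<^sup>2"
    by (simp add: power2_eq_square)
  finally show ?thesis
    by (rule power2_le_imp_le) (use assms in simp)
qed

lemma minkowski_sq:
  "(sqrt (E (\<lambda>x. (f x)\<^sup>2)) - sqrt (E (\<lambda>x. (g x)\<^sup>2)))\<^sup>2 \<le> E (\<lambda>x. (f x - g x)\<^sup>2)"
proof -
  let ?a = "E (\<lambda>x. (f x)\<^sup>2)" and ?b = "E (\<lambda>x. f x * g x)" and ?c = "E (\<lambda>x. (g x)\<^sup>2)"
  have ac: "0 \<le> ?a" "0 \<le> ?c"
    by (auto intro: nonneg)
  have "\<bar>?b\<bar> \<le> sqrt (?a * ?c)"
    using cauchy_schwarz[of f g] by (simp add: real_le_rsqrt)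
  then have "?a + ?c - 2 * (sqrt ?a * sqrt ?c) \<le> ?a + ?c - 2 * ?b"
    by (simp add: real_sqrt_mult)
  moreover have "(\<lambda>x. (f x - g x)\<^sup>2) = (\<lambda>x. (f x)\<^sup>2 + (g x)\<^sup>2 - 2 * (f x * g x))"
    by (auto simp: power2_eq_square algebra_simps)
  then have "E (\<lambda>x. (f x - g x)\<^sup>2) = ?a + ?c - 2 * ?b"
    by (simp only: add diff scale)
  ultimately show ?thesis
    using ac by (simp add: power2_diff)
qed

lemma abs_diff_mean_le:
  assumes "\<And>y z. y \<in> \<Omega> \<Longrightarrow> z \<in> \<Omega> \<Longrightarrow> f y - f z \<le> d" and x: "x \<in> \<Omega>"
  shows "\<bar>f x - E f\<bar> \<le> d"
proof -
  have "E (\<lambda>y. f y - f x) \<le> E (\<lambda>y. d)" "E (\<lambda>y. f x - f y) \<le> E (\<lambda>y. d)"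
    using assms by (auto intro!: mono)
  then show ?thesis
    by (simp add: diff const abs_le_iff)
qed

text \<open>The mean minimises the squared deviation, so it may be replaced by the midpoint of the
  range. The factor 4 gained over the crude bound by the full range is what makes the variance
  induction close.\<close>

lemma popoviciu:
  assumes fin: "finite \<Omega>" "\<Omega> \<noteq> {}"
    and osc: "\<And>y z. y \<in> \<Omega> \<Longrightarrow> z \<in> \<Omega> \<Longrightarrow> f y - f z \<le> 2 * d"
  shows "E (\<lambda>x. (f x - E f)\<^sup>2) \<le> d\<^sup>2"
proof -
  let ?c = "(Max (f ` \<Omega>) + Min (f ` \<Omega>)) / 2"
  have "Max (f ` \<Omega>) \<in> f ` \<Omega>" "Min (f ` \<Omega>) \<in> f ` \<Omega>"
    using fin by (auto intro!: Max_in Min_in)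
  then have width: "Max (f ` \<Omega>) - Min (f ` \<Omega>) \<le> 2 * d"
    using osc by auto
  have "E (\<lambda>x. (f x - E f)\<^sup>2) \<le> E (\<lambda>x. (f x - ?c)\<^sup>2)"
    by (rule variance_le)
  also have "\<dots> \<le> E (\<lambda>x. d\<^sup>2)"
  proof (rule mono)
    fix x assume "x \<in> \<Omega>"
    then have "f x \<le> Max (f ` \<Omega>)" "Min (f ` \<Omega>) \<le> f x"
      using fin by auto
    then have "\<bar>f x - ?c\<bar> \<le> d"
      using width by (simp add: abs_le_iff field_simps)
    then show "(f x - ?c)\<^sup>2 \<le> d\<^sup>2"
      using power_mono[of "\<bar>f x - ?c\<bar>" d 2] by simp
  qed
  finally show ?thesis
    by (simp add: const)
qed

lemma sum:
  "finite A \<Longrightarrow> E (\<lambda>x. \<Sum>a\<in>A. f a x) = (\<Sum>a\<in>A. E (f a))"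
  by (induction A rule: finite_induct) (auto simp: const add)

text \<open>Here x and y act as independent copies under the same law.\<close>

lemma mean_diff_mult_diff:
  "E (\<lambda>x. E (\<lambda>y. (f x - f y) * (g x - g y))) = 2 * (E (\<lambda>x. f x * g x) - E f * E g)"
proof -
  have "(\<lambda>x. E (\<lambda>y. (f x - f y) * (g x - g y))) =
      (\<lambda>x. (f x * g x + E (\<lambda>y. f y * g y)) - (f x * E g + g x * E f))"
  proof
    fix x
    have "(\<lambda>y. (f x - f y) * (g x - g y)) =
        (\<lambda>y. (f x * g x + f y * g y) - (f x * g y + g x * f y))"
      by (auto simp: algebra_simps)
    then show "E (\<lambda>y. (f x - f y) * (g x - g y)) =
        (f x * g x + E (\<lambda>y. f y * g y)) - (f x * E g + g x * E f)"
      by (simp only: diff add scale const)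
  qed
  then show ?thesis
    by (simp only: diff add scale_right const) simp
qed

text \<open>Positivity of the functional gives only weak inequalities; strictness comes from the
  tangent of exp at the mean, that is, from Jensen.\<close>

lemma mean_exp_pos: "0 < E (\<lambda>x. exp (v x))"
proof -
  let ?m = "E v"
  have "exp ?m = E (\<lambda>x. exp ?m * (1 + (v x - ?m)))"
    by (simp only: scale add diff const) simp
  also have "\<dots> \<le> E (\<lambda>x. exp (v x))"
  proof (rule mono)
    fix x
    have "exp ?m * (1 + (v x - ?m)) \<le> exp ?m * exp (v x - ?m)"
      by (intro mult_left_mono exp_ge_add_one_self) simp
    then show "exp ?m * (1 + (v x - ?m)) \<le> exp (v x)"
      by (simp flip: exp_add)
  qed
  finally show ?thesis
    by (rule less_le_trans[OF exp_gt_zero])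
qed

text \<open>There is no notion of null set here. Instead \<open>w \<le> t + w^2 / t\<close> is
  weighted by F: the first term vanishes because F has mean 0, and the second tends to 0 as t
  grows.\<close>

lemma mean_mult_eq_0:
  assumes F: "\<And>x. x \<in> \<Omega> \<Longrightarrow> 0 \<le> F x" and "E F = 0"
  shows "E (\<lambda>x. F x * v x) = 0"
proof -
  have le: "E (\<lambda>x. F x * w x) \<le> 0" for w
  proof (rule field_le_epsilon)
    fix e :: real
    let ?k = "E (\<lambda>x. F x * (w x)\<^sup>2)"
    have k: "0 \<le> ?k"
      using F by (intro nonneg) auto
    assume e: "0 < e"
    define t where "t = (?k + 1) / e"
    have t: "0 < t"
      using k e by (simp add: t_def)
    have "E (\<lambda>x. F x * w x) \<le> E (\<lambda>x. t * F x + (1 / t) * (F x * (w x)\<^sup>2))"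
    proof (rule mono)
      fix x assume x: "x \<in> \<Omega>"
      have "t * w x \<le> t\<^sup>2 + (w x)\<^sup>2"
        using sum_squares_bound[of t "w x"] zero_le_power2[of t] zero_le_power2[of "w x"]
        by linarith
      then have "w x \<le> t + (w x)\<^sup>2 / t"
        using t by (simp add: field_simps power2_eq_square)
      then have "F x * w x \<le> F x * (t + (w x)\<^sup>2 / t)"
        using F[OF x] by (rule mult_left_mono)
      then show "F x * w x \<le> t * F x + (1 / t) * (F x * (w x)\<^sup>2)"
        by (simp add: algebra_simps)
    qed
    also have "\<dots> = ?k / t"
      using assms by (simp only: add scale) simp
    also have "\<dots> \<le> 0 + e"
      using k e by (simp add: t_def field_simps)
    finally show "E (\<lambda>x. F x * w x) \<le> 0 + e" .
  qed
  show ?thesis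
    using le[of v] le[of "\<lambda>x. - v x"] by (simp add: uminus)
qed

text \<open>The Donsker-Varadhan principle, obtained by averaging the pointwise inequality F v <= F
  ln F - F ln a - F + a e^v, which is ln y <= y - 1 at y = a e^v / F.\<close>

lemma ent_variational:
  assumes F: "\<And>x. x \<in> \<Omega> \<Longrightarrow> 0 \<le> F x"
  shows "E (\<lambda>x. F x * v x) \<le> ent F + E F * ln (E (\<lambda>x. exp (v x)))"
proof (cases "E F = 0")
  case True
  then show ?thesis
    using mean_mult_eq_0[OF F True] by (simp add: ent_def)
next
  case False
  then have pos: "0 < E F"
    using nonneg[of F] F by force
  let ?Z = "E (\<lambda>x. exp (v x))"
  \<comment> \<open>With this value the terms -E F and a E(e^v) cancel after averaging.\<close>
  define a where "a = E F / ?Z"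
  have Z: "0 < ?Z"
    by (rule mean_exp_pos)
  have a: "0 < a"
    using pos Z by (simp add: a_def)
  have "E (\<lambda>x. F x * v x) \<le> E (\<lambda>x. F x * ln (F x) - F x * ln a - F x + a * exp (v x))"
  proof (rule mono)
    fix x assume x: "x \<in> \<Omega>"
    show "F x * v x \<le> F x * ln (F x) - F x * ln a - F x + a * exp (v x)"
    proof (cases "F x = 0")
      case True
      then show ?thesis
        using a by simp
    next
      case False
      then have Fx: "0 < F x"
        using F[OF x] by simp
      have "ln (a * exp (v x) / F x) \<le> a * exp (v x) / F x - 1"
        using a Fx by (intro ln_le_minus_one) simp
      then have "ln a + v x - ln (F x) \<le> a * exp (v x) / F x - 1"
        using a Fx by (simp add: ln_div ln_mult)
      then have "F x * (ln a + v x - ln (F x)) \<le> F x * (a * exp (v x) / F x - 1)"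
        using Fx by (simp add: mult_left_mono)
      then show ?thesis
        using Fx by (simp add: algebra_simps)
    qed
  qed
  also have "\<dots> = E (\<lambda>x. F x * ln (F x)) - E F * ln a - E F + a * ?Z"
    by (simp only: add diff scale scale_right)
  also have "\<dots> = ent F + E F * ln ?Z"
    using pos Z by (simp add: ent_def a_def ln_div algebra_simps)
  finally show ?thesis .
qed

lemma ent_nonneg:
  assumes "\<And>x. x \<in> \<Omega> \<Longrightarrow> 0 \<le> F x"
  shows "0 \<le> ent F"
  using ent_variational[OF assms, where v = "\<lambda>x. 0"] by (simp add: const)

text \<open>The variational principle is applied to \<open>t * u\<close> and \<open>- t * u\<close>,
  and the free parameter t is then optimised.\<close>

lemma subgaussian_covariance_sq_le:
  assumes F: "\<And>x. x \<in> \<Omega> \<Longrightarrow> 0 \<le> F x" and "0 \<le> c"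
    and mgf: "\<And>t. E (\<lambda>x. exp (t * u x)) \<le> exp (t * E u + c * t\<^sup>2)"
  shows "(E (\<lambda>x. F x * u x) - E F * E u)\<^sup>2 \<le> 4 * c * E F * ent F"
proof -
  let ?A = "E (\<lambda>x. F x * u x) - E F * E u"
  have EF: "0 \<le> E F"
    using F by (rule nonneg)
  have one_sided: "s * ?A * t \<le> ent F + E F * c * t\<^sup>2" if "\<bar>s\<bar> = 1" for s t
  proof -
    have "s * t * E (\<lambda>x. F x * u x) = E (\<lambda>x. F x * ((s * t) * u x))"
      using scale[of "s * t" "\<lambda>x. F x * u x"] by (simp add: algebra_simps)
    also have "\<dots> \<le> ent F + E F * ln (E (\<lambda>x. exp ((s * t) * u x)))"
      by (rule ent_variational[OF F])
    also have "\<dots> \<le> ent F + E F * (s * t * E u + c * (s * t)\<^sup>2)"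
    proof -
      have "ln (E (\<lambda>x. exp ((s * t) * u x))) \<le> ln (exp (s * t * E u + c * (s * t)\<^sup>2))"
        using mgf[of "s * t"] mean_exp_pos[of "\<lambda>x. s * t * u x"] by (intro ln_mono) auto
      then show ?thesis
        using EF by (intro add_left_mono mult_left_mono) auto
    qed
    also have "(s * t)\<^sup>2 = t\<^sup>2"
      using that by (simp add: power_mult_distrib abs_square_eq_1)
    finally show ?thesis
      by (simp add: algebra_simps)
  qed
  have "?A\<^sup>2 \<le> 4 * ent F * (E F * c)"
  proof (rule square_le_of_affine_bounds)
    fix t :: real
    assume t: "0 < t"
    have "\<bar>?A\<bar> * t \<le> ent F + E F * c * t\<^sup>2"
      using one_sided[of 1 t] one_sided[of "-1" t] by (simp add: abs_if)
    then show "\<bar>?A\<bar> \<le> ent F / t + E F * c * t"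
      using t by (simp add: field_simps power2_eq_square)
  qed (use ent_nonneg[OF F] EF assms in auto)
  then show ?thesis
    by (simp add: algebra_simps)
qed

lemma mgf_le:
  assumes "\<And>x. x \<in> \<Omega> \<Longrightarrow> \<bar>v x - E v\<bar> \<le> d"
  shows "E (\<lambda>x. exp (v x)) \<le> exp (E v + d\<^sup>2)"
proof -
  have "E (\<lambda>x. exp (v x)) = exp (E v) * E (\<lambda>x. exp (v x - E v))"
    by (simp flip: scale exp_add)
  also have "\<dots> \<le> exp (E v) * E (\<lambda>x. (v x - E v) + exp (d\<^sup>2))"
  proof (intro mult_left_mono mono)
    fix x assume "x \<in> \<Omega>"
    then have "(v x - E v)\<^sup>2 \<le> d\<^sup>2"
      using power_mono[OF assms, of x 2] by simp
    then have "exp ((v x - E v)\<^sup>2) \<le> exp (d\<^sup>2)"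
      by simp
    then show "exp (v x - E v) \<le> (v x - E v) + exp (d\<^sup>2)"
      using exp_le_self_plus_exp_sq[of "v x - E v"] by linarith
  qed simp
  also have "\<dots> = exp (E v + d\<^sup>2)"
    by (simp only: add diff const) (simp add: exp_add)
  finally show ?thesis .
qed

text \<open>The constant b is a lower bound for the mass of every atom. From ln y <= y - 1 the
  entropy of G = g^2 is at most Var(G) / E G, and the atom bound G <= E G / b reduces Var(G) to the
  variance of g.\<close>

lemma ent_square_le:
  assumes "0 < b" and b: "\<And>F x. (\<And>y. y \<in> \<Omega> \<Longrightarrow> 0 \<le> F y) \<Longrightarrow> x \<in> \<Omega> \<Longrightarrow> b * F x \<le> E F"
    and "b \<le> 1"
  shows "ent (\<lambda>x. (g x)\<^sup>2) \<le> 4 / b * E (\<lambda>x. (g x - E g)\<^sup>2)"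
proof -
  let ?G = "\<lambda>x. (g x)\<^sup>2" and ?m = "E g" and ?V = "E (\<lambda>x. (g x - E g)\<^sup>2)"
  have G0: "0 \<le> E ?G"
    by (rule nonneg) simp
  have V: "0 \<le> ?V"
    by (rule nonneg) simp
  show ?thesis
  proof (cases "E ?G = 0")
    case True
    then have "ent ?G = 0"
      using mean_mult_eq_0[of ?G "\<lambda>x. ln (?G x)"] by (simp add: ent_def)
    then show ?thesis
      using V assms by simp
  next
    case False
    then have G: "0 < E ?G"
      using G0 by simp
    have "E (\<lambda>x. ?G x * ln (?G x)) \<le> E (\<lambda>x. ?G x * ln (E ?G) + (1 / E ?G * (?G x)\<^sup>2 - ?G x))"
    proof (rule mono)
      fix x
      show "?G x * ln (?G x) \<le> ?G x * ln (E ?G) + (1 / E ?G * (?G x)\<^sup>2 - ?G x)"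
      proof (cases "?G x = 0")
        case False
        then have "ln (?G x / E ?G) \<le> ?G x / E ?G - 1"
          using G by (intro ln_le_minus_one) simp
        then have "ln (?G x) - ln (E ?G) \<le> ?G x / E ?G - 1"
          using False G by (subst (asm) ln_div) auto
        then have "?G x * (ln (?G x) - ln (E ?G)) \<le> ?G x * (?G x / E ?G - 1)"
          by (intro mult_left_mono) auto
        then show ?thesis
          by (simp add: algebra_simps power2_eq_square)
      qed simp
    qed
    also have "\<dots> = E ?G * ln (E ?G) + (1 / E ?G * E (\<lambda>x. (?G x)\<^sup>2) - E ?G)"
      by (simp only: add diff scale scale_right)
    finally have "ent ?G \<le> 1 / E ?G * (E (\<lambda>x. (?G x)\<^sup>2) - (E ?G)\<^sup>2)"
      using G by (simp add: ent_def field_simps power2_eq_square)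
    \<comment> \<open>Centring at the squared mean of g instead of E G makes the difference factor
      as (g - m)(g + m).\<close>
    also have "\<dots> \<le> 1 / E ?G * E (\<lambda>x. (?G x - ?m\<^sup>2)\<^sup>2)"
      using G variance_le[of ?G "?m\<^sup>2"] by (intro mult_left_mono) (auto simp: variance_eq)
    also have "\<dots> \<le> 1 / E ?G * E (\<lambda>x. (4 / b * E ?G) * (g x - ?m)\<^sup>2)"
    proof (intro mult_left_mono mono)
      fix x assume x: "x \<in> \<Omega>"
      have "?G x \<le> E ?G / b"
        using b[of ?G x] x \<open>0 < b\<close> by (simp add: field_simps)
      moreover have "?m\<^sup>2 \<le> E ?G / b"
      proof -
        have "E ?G * b \<le> E ?G"
          using G \<open>b \<le> 1\<close> by simp
        then have "E ?G \<le> E ?G / b"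
          using \<open>0 < b\<close> by (simp add: field_simps)
        then show ?thesis
          using square_mean_le[of g] by linarith
      qed
      moreover have "(g x + ?m)\<^sup>2 \<le> 2 * ?G x + 2 * ?m\<^sup>2"
        using sum_squares_bound[of "g x" ?m] by (simp add: power2_sum)
      ultimately have "(g x + ?m)\<^sup>2 \<le> 4 / b * E ?G"
        by (simp add: field_simps)
      then have "(g x + ?m)\<^sup>2 * (g x - ?m)\<^sup>2 \<le> (4 / b * E ?G) * (g x - ?m)\<^sup>2"
        by (rule mult_right_mono) simp
      moreover have "(?G x - ?m\<^sup>2)\<^sup>2 = (g x + ?m)\<^sup>2 * (g x - ?m)\<^sup>2"
        by (simp add: power2_eq_square algebra_simps)
      ultimately show "(?G x - ?m\<^sup>2)\<^sup>2 \<le> (4 / b * E ?G) * (g x - ?m)\<^sup>2"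
        by simp
    qed (use G in simp)
    also have "\<dots> = 4 / b * ?V"
      using G by (simp only: scale) simp
    finally show ?thesis .
  qed
qed

end

lemma positive_mean_weighted_sum:
  assumes "\<And>x. x \<in> A \<Longrightarrow> 0 \<le> p x" "sum p A = 1"
  shows "positive_mean A (\<lambda>f. \<Sum>x\<in>A. p x * f x)"
  using assms
  by unfold_locales
    (auto simp: algebra_simps sum.distrib sum_distrib_left intro!: sum_nonneg)

section \<open>Summation over the first sites\<close>

text \<open>Configurations stay total functions for every n: sites beyond n keep the values of the
  last argument. The recursion exposes site n + 1 as the outermost sum, the form needed for adding
  sites one at a time.\<close>

primrec site_sum :: "nat \<Rightarrow> nat \<Rightarrow> ((nat \<Rightarrow> nat) \<Rightarrow> real) \<Rightarrow> (nat \<Rightarrow> nat) \<Rightarrow> real" where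
  "site_sum q 0 F = F"
| "site_sum q (Suc n) F = (\<lambda>\<tau>. \<Sum>x=1..q. site_sum q n F (\<tau>(Suc n := x)))"

lemma site_sum_add:
  "site_sum q n (\<lambda>\<eta>. F \<eta> + G \<eta>) \<tau> = site_sum q n F \<tau> + site_sum q n G \<tau>"
  by (induction n arbitrary: \<tau>) (auto simp: sum.distrib)

lemma site_sum_scale: "site_sum q n (\<lambda>\<eta>. c * F \<eta>) \<tau> = c * site_sum q n F \<tau>"
  by (induction n arbitrary: \<tau>) (auto simp: sum_distrib_left)

lemma site_sum_mono:
  assumes "\<And>\<eta>. F \<eta> \<le> G \<eta>"
  shows "site_sum q n F \<tau> \<le> site_sum q n G \<tau>"
  using assms by (induction n arbitrary: \<tau>) (auto intro: sum_mono)

lemma site_sum_nonneg: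
  assumes "\<And>\<eta>. 0 \<le> F \<eta>"
  shows "0 \<le> site_sum q n F \<tau>"
  using assms by (induction n arbitrary: \<tau>) (auto intro: sum_nonneg)

lemma site_sum_pos:
  assumes "\<And>\<eta>. 0 < F \<eta>" "0 < q"
  shows "0 < site_sum q n F \<tau>"
  using assms by (induction n arbitrary: \<tau>) (auto intro: sum_pos)

lemma site_sum_upd:
  assumes "n < i"
  shows "site_sum q n F (\<tau>(i := x)) = site_sum q n (\<lambda>\<eta>. F (\<eta>(i := x))) \<tau>"
  using assms
proof (induction n arbitrary: \<tau>)
  case (Suc n)
  then have comm: "\<tau>(i := x, Suc n := z) = \<tau>(Suc n := z, i := x)" for z
    by (auto simp: fun_upd_twist)
  show ?case
    unfolding site_sum.simps comm using Suc.prems by (intro sum.cong refl Suc.IH) simp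
qed simp

text \<open>The sum over x forgets the value of site i, so the outer summation over that value
  repeats the same number q times.\<close>

lemma site_sum_resample:
  assumes "i \<in> {1..n}"
  shows "site_sum q n (\<lambda>\<eta>. \<Sum>x=1..q. F (\<eta>(i := x))) \<tau> = real q * site_sum q n F \<tau>"
  using assms
proof (induction n arbitrary: \<tau>)
  case (Suc n)
  show ?case
  proof (cases "i = Suc n")
    case True
    have sum: "site_sum q n (\<lambda>\<eta>. \<Sum>x\<in>A. G x \<eta>) \<tau> = (\<Sum>x\<in>A. site_sum q n (G x) \<tau>)"
      if "finite A" for A :: "nat set" and G \<tau>
      using that
      by (induction A) (use site_sum_scale[of q n 0] in \<open>auto simp: site_sum_add\<close>)
    have "site_sum q n (\<lambda>\<eta>. F (\<eta>(Suc n := z))) (\<tau>(Suc n := x)) = site_sum q n F (\<tau>(Suc n := z))"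
      for x z
      by (metis fun_upd_upd lessI site_sum_upd)
    then show ?thesis
      by (simp only: True site_sum.simps sum[OF finite_atLeastAtMost] sum_constant) simp
  next
    case False
    then show ?thesis
      using Suc by (simp add: sum_distrib_left)
  qed
qed simp

section \<open>Weakly dependent spin systems\<close>

text \<open>M controls the influence of one spin on the weight, and \<open>\<epsilon>\<close>
  controls the cross ratio of two spins, which is 1 when they do not interact. The last assumption
  says that the N interactions felt by one site are small in total.\<close>

locale spin_system =
  fixes N q :: nat and W :: "(nat \<Rightarrow> nat) \<Rightarrow> real" and M \<epsilon> :: real
  assumes q_pos: "0 < q" and M_ge_1: "1 \<le> M" and eps_nonneg: "0 \<le> \<epsilon>"
    and W_pos: "0 < W \<tau>"
    and ratio_le: "i \<in> {1..N} \<Longrightarrow> x \<in> {1..q} \<Longrightarrow> y \<in> {1..q} \<Longrightarrow>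
      W (\<tau>(i := x)) \<le> M * W (\<tau>(i := y))"
    and mixed_ratio_le:
      "i \<in> {1..N} \<Longrightarrow> j \<in> {1..N} \<Longrightarrow> i \<noteq> j \<Longrightarrow> x \<in> {1..q} \<Longrightarrow> y \<in> {1..q} \<Longrightarrow>
       z \<in> {1..q} \<Longrightarrow> z' \<in> {1..q} \<Longrightarrow>
      W (\<tau>(i := x, j := z)) * W (\<tau>(i := y, j := z')) \<le>
        (1 + \<epsilon>) * (W (\<tau>(i := y, j := z)) * W (\<tau>(i := x, j := z')))"
    and small: "real N * \<epsilon> * M\<^sup>2 \<le> 1"
begin

text \<open>\<open>E n \<tau>\<close> is the Gibbs expectation over the sites \<open>1, \<dots>, n\<close> with the remaining sites
  frozen at \<open>\<tau>\<close>.\<close>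

definition E :: "nat \<Rightarrow> (nat \<Rightarrow> nat) \<Rightarrow> ((nat \<Rightarrow> nat) \<Rightarrow> real) \<Rightarrow> real" where
  "E n \<tau> F = site_sum q n (\<lambda>\<eta>. W \<eta> * F \<eta>) \<tau> / site_sum q n W \<tau>"

text \<open>The law of site n + 1 with the sites 1 to n averaged out, in contrast to
  \<open>cond_prob\<close> below, where all other sites are fixed.\<close>

definition p :: "nat \<Rightarrow> (nat \<Rightarrow> nat) \<Rightarrow> nat \<Rightarrow> real" where
  "p n \<tau> x = site_sum q n W (\<tau>(Suc n := x)) / site_sum q (Suc n) W \<tau>"

lemma Z_pos: "0 < site_sum q n W \<tau>"
  by (rule site_sum_pos[OF W_pos q_pos])

lemma sum_Z_pos: "0 < (\<Sum>x=1..q. site_sum q n W (\<tau>(i := x)))"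
  using q_pos Z_pos by (intro sum_pos) auto

lemma p_pos: "0 < p n \<tau> x"
  unfolding p_def using Z_pos by (intro divide_pos_pos)

lemma sum_p: "(\<Sum>x=1..q. p n \<tau> x) = 1"
  using sum_Z_pos[of n \<tau> "Suc n"] by (simp add: p_def flip: sum_divide_distrib)

sublocale mean: positive_mean UNIV "E n \<tau>" for n \<tau>
proof
  fix f g :: "(nat \<Rightarrow> nat) \<Rightarrow> real" and c
  show "E n \<tau> (\<lambda>x. f x + g x) = E n \<tau> f + E n \<tau> g"
    by (simp add: E_def distrib_left site_sum_add add_divide_distrib)
  have "(\<lambda>\<eta>. W \<eta> * (c * f \<eta>)) = (\<lambda>\<eta>. c * (W \<eta> * f \<eta>))"
    by auto
  then show "E n \<tau> (\<lambda>x. c * f x) = c * E n \<tau> f"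
    by (simp add: E_def site_sum_scale)
  show "0 \<le> E n \<tau> f" if "\<And>x. x \<in> UNIV \<Longrightarrow> 0 \<le> f x"
    unfolding E_def using that Z_pos W_pos
    by (intro divide_nonneg_pos site_sum_nonneg mult_nonneg_nonneg) (auto intro: less_imp_le)
  show "E n \<tau> (\<lambda>x. 1) = 1"
    using Z_pos[of n \<tau>] by (simp add: E_def)
qed

sublocale site: positive_mean "{1..q}" "\<lambda>g. \<Sum>x=1..q. p n \<tau> x * g x" for n \<tau>
  by (rule positive_mean_weighted_sum) (auto simp: sum_p less_imp_le[OF p_pos] simp del: One_nat_def)

lemma E_0: "E 0 \<tau> F = F \<tau>"
  using W_pos[of \<tau>] by (simp add: E_def)

lemma E_Suc: "E (Suc n) \<tau> F = (\<Sum>x=1..q. p n \<tau> x * E n (\<tau>(Suc n := x)) F)"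
proof -
  have "p n \<tau> x * E n (\<tau>(Suc n := x)) F =
      site_sum q n (\<lambda>\<eta>. W \<eta> * F \<eta>) (\<tau>(Suc n := x)) / site_sum q (Suc n) W \<tau>" for x
    using Z_pos[of n "\<tau>(Suc n := x)"] by (simp add: p_def E_def)
  then show ?thesis
    unfolding E_def[of "Suc n"] by (simp add: sum_divide_distrib)
qed

lemma E_upd: "n < i \<Longrightarrow> E n (\<tau>(i := y)) (\<lambda>\<eta>. F (\<eta>(i := y))) = E n (\<tau>(i := y)) F"
  by (simp add: E_def site_sum_upd)

section \<open>Density ratios and Lipschitz functions\<close>

text \<open>The unnormalised density of the measure with site i frozen at x relative to the one
  frozen at y.\<close>

definition r :: "nat \<Rightarrow> nat \<Rightarrow> nat \<Rightarrow> (nat \<Rightarrow> nat) \<Rightarrow> real" where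
  "r i x y \<eta> = W (\<eta>(i := x)) / W (\<eta>(i := y))"

lemma r_bounds:
  assumes "i \<in> {1..N}" "x \<in> {1..q}" "y \<in> {1..q}"
  shows "1 / M \<le> r i x y \<eta>" "r i x y \<eta> \<le> M"
  using ratio_le[OF assms, of \<eta>] ratio_le[OF assms(1,3,2), of \<eta>] W_pos[of "\<eta>(i := y)"] M_ge_1
  by (auto simp: r_def field_simps)

lemma mean_r_bounds:
  assumes "i \<in> {1..N}" "x \<in> {1..q}" "y \<in> {1..q}"
  shows "1 / M \<le> E n \<tau> (r i x y)"
  using mean.mono[of "\<lambda>_. 1 / M" "r i x y" n \<tau>] r_bounds(1)[OF assms] by (simp add: mean.const)

lemma E_change:
  assumes "n < i"
  shows "E n (\<tau>(i := x)) F =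
    E n (\<tau>(i := y)) (\<lambda>\<eta>. r i x y \<eta> * F (\<eta>(i := x))) / E n (\<tau>(i := y)) (r i x y)"
proof -
  have W: "W (\<eta>(i := y)) * r i x y (\<eta>(i := y)) = W (\<eta>(i := x))" for \<eta>
    using W_pos[of "\<eta>(i := y)"] by (simp add: r_def)
  have W': "W (\<eta>(i := y)) * (r i x y (\<eta>(i := y)) * a) = W (\<eta>(i := x)) * a" for \<eta> a
    using W[of \<eta>] by (metis mult.assoc)
  show ?thesis
    using Z_pos[of n "\<tau>(i := y)"] assms by (simp add: E_def site_sum_upd W W')
qed

lemma Z_ratio_le:
  assumes "n < i" "i \<in> {1..N}" "x \<in> {1..q}" "y \<in> {1..q}"
  shows "site_sum q n W (\<tau>(i := x)) \<le> M * site_sum q n W (\<tau>(i := y))"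
  unfolding site_sum_upd[OF assms(1)] site_sum_scale[symmetric]
  by (intro site_sum_mono ratio_le assms)

lemma weight_ge:
  assumes "x \<in> {1..q}" "\<And>y. y \<in> {1..q} \<Longrightarrow> w y \<le> M * w x" "0 < w x" "0 < (\<Sum>y=1..q. w y)"
  shows "1 / (real q * M) \<le> w x / (\<Sum>y=1..q. w y)"
proof -
  have "(\<Sum>y=1..q. w y) \<le> real q * (M * w x)"
    using sum_bounded_above[of "{1..q}" w "M * w x"] assms by simp
  then show ?thesis
    using assms q_pos M_ge_1 by (simp add: field_simps)
qed

lemma p_ge:
  assumes "n < N" "x \<in> {1..q}"
  shows "1 / (real q * M) \<le> p n \<tau> x"
  unfolding p_def site_sum.simps
  using assms Z_ratio_le[of n "Suc n"] Z_pos sum_Z_pos by (intro weight_ge) auto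

text \<open>A one-sided bound suffices because x and y may be exchanged.\<close>

definition lip :: "real \<Rightarrow> ((nat \<Rightarrow> nat) \<Rightarrow> real) \<Rightarrow> bool" where
  "lip l u \<longleftrightarrow> (\<forall>j\<in>{1..N}. \<forall>x\<in>{1..q}. \<forall>y\<in>{1..q}. \<forall>\<eta>. u (\<eta>(j := x)) - u (\<eta>(j := y)) \<le> l)"

lemma lipD:
  "lip l u \<Longrightarrow> j \<in> {1..N} \<Longrightarrow> x \<in> {1..q} \<Longrightarrow> y \<in> {1..q} \<Longrightarrow> u (\<eta>(j := x)) - u (\<eta>(j := y)) \<le> l"
  unfolding lip_def by blast

lemma lip_scale:
  assumes "lip l u"
  shows "lip (\<bar>c\<bar> * l) (\<lambda>\<eta>. c * u \<eta>)"
  unfolding lip_def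
proof (intro ballI allI)
  fix j x y \<eta>
  assume *: "j \<in> {1..N}" "x \<in> {1..q}" "y \<in> {1..q}"
  have "\<bar>u (\<eta>(j := x)) - u (\<eta>(j := y))\<bar> \<le> l"
    using lipD[OF assms *, of \<eta>] lipD[OF assms *(1,3,2), of \<eta>] by linarith
  then have "\<bar>c\<bar> * \<bar>u (\<eta>(j := x)) - u (\<eta>(j := y))\<bar> \<le> \<bar>c\<bar> * l"
    by (rule mult_left_mono) simp
  then have "c * (u (\<eta>(j := x)) - u (\<eta>(j := y))) \<le> \<bar>c\<bar> * l"
    by (metis abs_ge_self abs_mult order_trans)
  then show "c * u (\<eta>(j := x)) - c * u (\<eta>(j := y)) \<le> \<bar>c\<bar> * l"
    by (simp only: right_diff_distrib)
qed

lemma lip_upd: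
  assumes "lip l u" "0 \<le> l"
  shows "lip l (\<lambda>\<eta>. u (\<eta>(i := x)))"
  unfolding lip_def
proof (intro ballI allI)
  fix j z y \<eta>
  assume *: "j \<in> {1..N}" "z \<in> {1..q}" "y \<in> {1..q}"
  show "u (\<eta>(j := z, i := x)) - u (\<eta>(j := y, i := x)) \<le> l"
    using assms lipD[OF assms(1) *, of "\<eta>(i := x)"]
    by (cases "i = j") (auto simp: fun_upd_twist)
qed

text \<open>For j different from i the cross ratio bound makes r change by a factor of at most 1 +
  \<epsilon>, and r is at most M. For j = i the update is overwritten and r does not change.\<close>

lemma lip_r:
  assumes "i \<in> {1..N}" "x \<in> {1..q}" "y \<in> {1..q}"
  shows "lip (\<epsilon> * M) (r i x y)"
  unfolding lip_def
proof (intro ballI allI)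
  fix j z z' \<eta>
  assume *: "j \<in> {1..N}" "z \<in> {1..q}" "z' \<in> {1..q}"
  show "r i x y (\<eta>(j := z)) - r i x y (\<eta>(j := z')) \<le> \<epsilon> * M"
  proof (cases "i = j")
    case True
    then show ?thesis
      using eps_nonneg M_ge_1 by (simp add: r_def)
  next
    case False
    have "r i x y (\<eta>(j := z)) \<le> (1 + \<epsilon>) * r i x y (\<eta>(j := z'))"
      using mixed_ratio_le[OF assms(1) *(1) False assms(2,3) *(2,3), of \<eta>]
        W_pos[of "\<eta>(i := y, j := z)"] W_pos[of "\<eta>(i := y, j := z')"] False
      by (simp add: r_def fun_upd_twist[of j i] field_simps)
    moreover have "\<epsilon> * r i x y (\<eta>(j := z')) \<le> \<epsilon> * M"
      using eps_nonneg r_bounds(2)[OF assms] by (intro mult_left_mono)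
    ultimately show ?thesis
      by (simp add: algebra_simps)
  qed
qed

subsection \<open>Concentration of Lipschitz functions\<close>

lemma mean_change_le:
  assumes var: "\<And>u l \<tau>. lip l u \<Longrightarrow> 0 \<le> l \<Longrightarrow> E n \<tau> (\<lambda>\<eta>. (u \<eta> - E n \<tau> u)\<^sup>2) \<le> real n * l\<^sup>2"
    and u: "lip l u" "0 \<le> l" and n: "n < N" and x: "x \<in> {1..q}" and y: "y \<in> {1..q}"
  shows "E n (\<tau>(Suc n := x)) u - E n (\<tau>(Suc n := y)) u \<le> 2 * l"
proof -
  let ?i = "Suc n" and ?E = "E n (\<tau>(Suc n := y))"
  let ?r = "r ?i x y" and ?ux = "\<lambda>\<eta>. u (\<eta>(?i := x))" and ?uy = "\<lambda>\<eta>. u (\<eta>(?i := y))"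
  have i: "?i \<in> {1..N}"
    using n by simp
  have r: "1 / M \<le> ?E ?r"
    using i x y by (rule mean_r_bounds)
  have M: "0 < M"
    using M_ge_1 by simp
  have r_pos: "0 < ?E ?r"
    using r M by (meson divide_pos_pos less_le_trans zero_less_one)
  have "?E (\<lambda>\<eta>. ?r \<eta> * ?ux \<eta>) - ?E ?r * ?E ?ux \<le> real n * (\<epsilon> * M) * l"
    using eps_nonneg M u by (intro mean.covariance_le_of_variances var lip_r lip_upd i x y) auto
  also have "\<dots> \<le> real N * (\<epsilon> * M) * l"
    using n eps_nonneg M u by (intro mult_right_mono) auto
  \<comment> \<open>One factor M is traded for 1 / M, the lower bound of E r, so that the division
    by E r is free.\<close>
  also have "\<dots> = (real N * \<epsilon> * M\<^sup>2) * l * (1 / M)"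
    using M by (simp add: power2_eq_square)
  also have "\<dots> \<le> 1 * l * ?E ?r"
    using small r M u eps_nonneg by (intro mult_mono) auto
  finally have "?E (\<lambda>\<eta>. ?r \<eta> * ?ux \<eta>) / ?E ?r - ?E ?ux \<le> l"
    using r_pos by (simp add: field_simps)
  then have "E n (\<tau>(?i := x)) u - ?E ?ux \<le> l"
    by (subst E_change[where y = y]) auto
  moreover have "?E ?ux - ?E u \<le> l"
  proof -
    have "?E (\<lambda>\<eta>. ?ux \<eta> - ?uy \<eta>) \<le> ?E (\<lambda>_. l)"
      using lipD[OF u(1) i x y] by (intro mean.mono)
    then show ?thesis
      by (simp add: mean.diff mean.const E_upd)
  qed
  ultimately show ?thesis
    by linarith
qed

text \<open>Law of total variance: the conditional variances contribute n l^2 by induction, and the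
  conditional means have range at most 2l, which contributes l^2 by Popoviciu.\<close>

lemma variance_lip_le:
  assumes "lip l u" "0 \<le> l" "n \<le> N"
  shows "E n \<tau> (\<lambda>\<eta>. (u \<eta> - E n \<tau> u)\<^sup>2) \<le> real n * l\<^sup>2"
  using assms
proof (induction n arbitrary: u l \<tau>)
  case 0
  then show ?case
    by (simp add: E_0)
next
  case (Suc n)
  define m where "m x = E n (\<tau>(Suc n := x)) u" for x
  let ?S = "\<lambda>g. \<Sum>x=1..q. p n \<tau> x * g x"
  have "E (Suc n) \<tau> (\<lambda>\<eta>. (u \<eta> - E (Suc n) \<tau> u)\<^sup>2) =
      E (Suc n) \<tau> (\<lambda>\<eta>. (u \<eta>)\<^sup>2) - (E (Suc n) \<tau> u)\<^sup>2"
    by (rule mean.variance_eq)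
  also have "\<dots> = ?S (\<lambda>x. E n (\<tau>(Suc n := x)) (\<lambda>\<eta>. (u \<eta>)\<^sup>2)) - (?S m)\<^sup>2"
    by (simp add: E_Suc m_def)
  also have "\<dots> = ?S (\<lambda>x. E n (\<tau>(Suc n := x)) (\<lambda>\<eta>. (u \<eta>)\<^sup>2) - (m x)\<^sup>2) + ?S (\<lambda>x. (m x - ?S m)\<^sup>2)"
    unfolding site.variance_eq site.diff by simp
  also have "\<dots> \<le> ?S (\<lambda>x. real n * l\<^sup>2) + l\<^sup>2"
  proof (rule add_mono)
    have "E n \<tau>' (\<lambda>\<eta>. (u \<eta>)\<^sup>2) - (E n \<tau>' u)\<^sup>2 \<le> real n * l\<^sup>2" for \<tau>'
      using Suc.IH[OF Suc.prems(1,2), of \<tau>'] Suc.prems(3) by (simp add: mean.variance_eq)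
    then show "?S (\<lambda>x. E n (\<tau>(Suc n := x)) (\<lambda>\<eta>. (u \<eta>)\<^sup>2) - (m x)\<^sup>2) \<le> ?S (\<lambda>x. real n * l\<^sup>2)"
      unfolding m_def by (intro site.mono)
    show "?S (\<lambda>x. (m x - ?S m)\<^sup>2) \<le> l\<^sup>2"
    proof (rule site.popoviciu)
      fix y z assume "y \<in> {1..q}" "z \<in> {1..q}"
      then show "m y - m z \<le> 2 * l"
        unfolding m_def using Suc by (intro mean_change_le) auto
    qed (use q_pos in auto)
  qed
  also have "\<dots> = real (Suc n) * l\<^sup>2"
    unfolding site.const by (simp add: algebra_simps)
  finally show ?case .
qed

lemma mean_osc_le:
  assumes "lip l u" "0 \<le> l" "n < N" "x \<in> {1..q}" "y \<in> {1..q}"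
  shows "E n (\<tau>(Suc n := x)) u - E n (\<tau>(Suc n := y)) u \<le> 2 * l"
  using assms by (intro mean_change_le variance_lip_le) auto

text \<open>The martingale of conditional means has increments of at most 2l, and each contributes
  (2l)^2 to the exponent.\<close>

lemma mgf_lip_le:
  assumes "lip l u" "0 \<le> l" "n \<le> N"
  shows "E n \<tau> (\<lambda>\<eta>. exp (u \<eta>)) \<le> exp (E n \<tau> u + 4 * real n * l\<^sup>2)"
  using assms(3)
proof (induction n arbitrary: \<tau>)
  case 0
  then show ?case
    by (simp add: E_0)
next
  case (Suc n)
  define m where "m x = E n (\<tau>(Suc n := x)) u" for x
  let ?S = "\<lambda>g. \<Sum>x=1..q. p n \<tau> x * g x"
  have "E (Suc n) \<tau> (\<lambda>\<eta>. exp (u \<eta>)) = ?S (\<lambda>x. E n (\<tau>(Suc n := x)) (\<lambda>\<eta>. exp (u \<eta>)))"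
    by (rule E_Suc)
  also have "\<dots> \<le> ?S (\<lambda>x. exp (4 * real n * l\<^sup>2) * exp (m x))"
  proof (rule site.mono)
    fix x
    have "E n (\<tau>(Suc n := x)) (\<lambda>\<eta>. exp (u \<eta>)) \<le> exp (m x + 4 * real n * l\<^sup>2)"
      unfolding m_def by (rule Suc.IH) (use Suc.prems in simp)
    then show "E n (\<tau>(Suc n := x)) (\<lambda>\<eta>. exp (u \<eta>)) \<le> exp (4 * real n * l\<^sup>2) * exp (m x)"
      by (simp only: exp_add mult.commute)
  qed
  also have "\<dots> \<le> exp (4 * real n * l\<^sup>2) * exp (?S m + (2 * l)\<^sup>2)"
    unfolding site.scale
  proof (intro mult_left_mono site.mgf_le)
    fix x assume "x \<in> {1..q}"
    then show "\<bar>m x - ?S m\<bar> \<le> 2 * l"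
      unfolding m_def using assms Suc.prems
      by (intro site.abs_diff_mean_le[where f = "\<lambda>x. E n (\<tau>(Suc n := x)) u"] mean_osc_le) auto
  qed simp
  also have "\<dots> = exp (E (Suc n) \<tau> u + 4 * real (Suc n) * l\<^sup>2)"
    by (simp add: E_Suc m_def power_mult_distrib algebra_simps flip: exp_add)
  finally show ?case .
qed

lemma lip_covariance_sq_le:
  assumes "lip l u" "0 \<le> l" "n \<le> N" "\<And>\<eta>. 0 \<le> F \<eta>"
  shows "(E n \<tau> (\<lambda>\<eta>. F \<eta> * u \<eta>) - E n \<tau> F * E n \<tau> u)\<^sup>2 \<le>
    16 * real n * l\<^sup>2 * E n \<tau> F * mean.ent n \<tau> F"
proof -
  have "(E n \<tau> (\<lambda>\<eta>. F \<eta> * u \<eta>) - E n \<tau> F * E n \<tau> u)\<^sup>2 \<le>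
      4 * (4 * real n * l\<^sup>2) * E n \<tau> F * mean.ent n \<tau> F"
  proof (rule mean.subgaussian_covariance_sq_le)
    fix t
    have "E n \<tau> (\<lambda>x. exp (t * u x)) \<le>
        exp (E n \<tau> (\<lambda>x. t * u x) + 4 * real n * (\<bar>t\<bar> * l)\<^sup>2)"
      using assms by (intro mgf_lip_le lip_scale) auto
    then show "E n \<tau> (\<lambda>x. exp (t * u x)) \<le> exp (t * E n \<tau> u + 4 * real n * l\<^sup>2 * t\<^sup>2)"
      by (simp add: mean.scale power_mult_distrib algebra_simps)
  qed (use assms in auto)
  then show ?thesis
    by simp
qed

subsection \<open>The logarithmic Sobolev inequality\<close>

definition cond_prob :: "nat \<Rightarrow> (nat \<Rightarrow> nat) \<Rightarrow> nat \<Rightarrow> real" where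
  "cond_prob i \<eta> y = W (\<eta>(i := y)) / (\<Sum>z=1..q. W (\<eta>(i := z)))"

text \<open>The contribution of site i to the squared difference operator.\<close>

definition local_energy :: "nat \<Rightarrow> ((nat \<Rightarrow> nat) \<Rightarrow> real) \<Rightarrow> (nat \<Rightarrow> nat) \<Rightarrow> real" where
  "local_energy i f \<eta> = (\<Sum>y=1..q. cond_prob i \<eta> y * (f \<eta> - f (\<eta>(i := y)))\<^sup>2)"

lemma sum_W_pos: "0 < (\<Sum>z=1..q. W (\<eta>(i := z)))"
  using sum_Z_pos[of 0] by simp

lemma cond_prob_pos: "0 < cond_prob i \<eta> y"
  unfolding cond_prob_def by (intro divide_pos_pos W_pos sum_W_pos)

lemma sum_cond_prob: "(\<Sum>y=1..q. cond_prob i \<eta> y) = 1"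
  using sum_W_pos[of \<eta> i] by (simp add: cond_prob_def flip: sum_divide_distrib)

lemma cond_prob_upd: "cond_prob i (\<eta>(i := x)) y = cond_prob i \<eta> y"
  by (simp add: cond_prob_def)

lemma cond_prob_ge:
  assumes "i \<in> {1..N}" "x \<in> {1..q}"
  shows "1 / (real q * M) \<le> cond_prob i \<eta> x"
  unfolding cond_prob_def using assms ratio_le[of i] W_pos sum_W_pos by (intro weight_ge) auto

sublocale cond: positive_mean "{1..q}" "\<lambda>g. \<Sum>x=1..q. cond_prob i \<eta> x * g x" for i \<eta>
  by (rule positive_mean_weighted_sum)
    (auto simp: sum_cond_prob less_imp_le[OF cond_prob_pos] simp del: One_nat_def)

text \<open>The change is routed through \<open>?C\<close>, the x-measure applied to the function
  with site n + 1 set to y. From \<open>?A\<close> to \<open>?C\<close> only the function changes,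
  which is Minkowski and yields energy; from \<open>?C\<close> to \<open>?B\<close> only the measure
  changes, which is a covariance with r and yields entropy.\<close>

lemma mean_sqrt_change_le:
  fixes f :: "(nat \<Rightarrow> nat) \<Rightarrow> real"
  assumes n: "n < N" and x: "x \<in> {1..q}" and y: "y \<in> {1..q}"
  defines "F \<equiv> \<lambda>\<eta>. (f \<eta>)\<^sup>2"
  shows "(sqrt (E n (\<tau>(Suc n := x)) F) - sqrt (E n (\<tau>(Suc n := y)) F))\<^sup>2 \<le>
    2 * E n (\<tau>(Suc n := x)) (\<lambda>\<eta>. (f \<eta> - f (\<eta>(Suc n := y)))\<^sup>2)
    + 32 / real N * mean.ent n (\<tau>(Suc n := y)) F"
proof -
  let ?i = "Suc n" and ?Ex = "E n (\<tau>(Suc n := x))" and ?Ey = "E n (\<tau>(Suc n := y))"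
  let ?Fy = "\<lambda>\<eta>. F (\<eta>(?i := y))" and ?r = "r ?i x y"
  let ?A = "?Ex F" and ?C = "?Ex ?Fy" and ?B = "?Ey F" and ?e = "mean.ent n (\<tau>(Suc n := y)) F"
  have i: "?i \<in> {1..N}"
    using n by simp
  have M: "0 < M"
    using M_ge_1 by simp
  have F: "0 \<le> F \<eta>" for \<eta>
    by (simp add: F_def)
  have e: "0 \<le> ?e"
    by (rule mean.ent_nonneg) (rule F)
  have B: "0 \<le> ?B" and C: "0 \<le> ?C"
    using F by (auto intro: mean.nonneg)
  have By: "?Ey ?Fy = ?B"
    by (rule E_upd) simp
  have ent_y: "mean.ent n (\<tau>(Suc n := y)) ?Fy = ?e"
    unfolding mean.ent_def By
    using E_upd[of n ?i \<tau> y "\<lambda>\<eta>. F \<eta> * ln (F \<eta>)"] by simp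
  have r: "1 / M \<le> ?Ey ?r"
    using i x y by (rule mean_r_bounds)
  have "(?C - ?B) * ?Ey ?r = ?Ey (\<lambda>\<eta>. ?Fy \<eta> * ?r \<eta>) - ?Ey ?Fy * ?Ey ?r"
  proof -
    have "?C = ?Ey (\<lambda>\<eta>. ?r \<eta> * ?Fy \<eta>) / ?Ey ?r"
      by (subst E_change[where y = y]) auto
    moreover have "0 < ?Ey ?r"
      using r M by (meson divide_pos_pos less_le_trans zero_less_one)
    ultimately show ?thesis
      unfolding By by (simp add: field_simps)
  qed
  then have "((?C - ?B) * ?Ey ?r)\<^sup>2 \<le> 16 * real n * (\<epsilon> * M)\<^sup>2 * ?B * ?e"
    using lip_covariance_sq_le[OF lip_r[OF i x y], of n ?Fy "\<tau>(?i := y)"] eps_nonneg M n F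
    by (simp only: By ent_y) simp
  moreover have "((?C - ?B) * (1 / M))\<^sup>2 \<le> ((?C - ?B) * ?Ey ?r)\<^sup>2"
    unfolding power_mult_distrib using r M by (intro mult_left_mono power_mono) auto
  ultimately have "((?C - ?B) * (1 / M))\<^sup>2 \<le> 16 * real n * (\<epsilon> * M)\<^sup>2 * ?B * ?e"
    by linarith
  then have "(?C - ?B)\<^sup>2 \<le> 16 * (real n * (\<epsilon> * M\<^sup>2)\<^sup>2) * (?B * ?e)"
    using M by (simp add: field_simps power2_eq_square)
  \<comment> \<open>The square of the smallness condition supplies the factor 1/N that keeps the
    product over N sites bounded.\<close>
  also have "\<dots> \<le> 16 * (1 / real N) * (?B * ?e)"
  proof -
    have "real n * (\<epsilon> * M\<^sup>2)\<^sup>2 * real N \<le> real N * (\<epsilon> * M\<^sup>2)\<^sup>2 * real N"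
      using n by (intro mult_right_mono) auto
    also have "\<dots> = (real N * \<epsilon> * M\<^sup>2)\<^sup>2"
      by (simp add: power2_eq_square)
    also have "\<dots> \<le> 1\<^sup>2"
      using small eps_nonneg by (intro power_mono) auto
    finally have "real n * (\<epsilon> * M\<^sup>2)\<^sup>2 \<le> 1 / real N"
      using n by (simp add: field_simps)
    then show ?thesis
      using B e by (intro mult_right_mono mult_left_mono mult_nonneg_nonneg) auto
  qed
  finally have CB: "(?C - ?B)\<^sup>2 \<le> 16 / real N * ?e * ?B"
    by (simp add: algebra_simps)
  \<comment> \<open>The factor \<open>?B\<close> in \<open>CB\<close> cancels on passing to square
    roots; if it is 0, then \<open>CB\<close> forces \<open>?C = 0\<close>.\<close>
  have measure_change: "(sqrt ?C - sqrt ?B)\<^sup>2 \<le> 16 / real N * ?e"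
  proof (cases "?B = 0")
    case True
    then have "?C = 0"
      using CB by simp
    then show ?thesis
      using True e by simp
  next
    case False
    have "(sqrt ?C - sqrt ?B)\<^sup>2 * ?B \<le> 16 / real N * ?e * ?B"
      using sqrt_diff_sq_mult_le[OF C B] CB by linarith
    then show ?thesis
      by (rule mult_right_le_imp_le) (use B False in simp)
  qed
  have "(sqrt ?A - sqrt ?C)\<^sup>2 \<le> ?Ex (\<lambda>\<eta>. (f \<eta> - f (\<eta>(?i := y)))\<^sup>2)"
    unfolding F_def by (rule mean.minkowski_sq)
  moreover have "(sqrt ?A - sqrt ?B)\<^sup>2 \<le> 2 * (sqrt ?A - sqrt ?C)\<^sup>2 + 2 * (sqrt ?C - sqrt ?B)\<^sup>2"
    using sum_squares_bound[of "sqrt ?A - sqrt ?C" "sqrt ?C - sqrt ?B"]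
      power2_sum[of "sqrt ?A - sqrt ?C" "sqrt ?C - sqrt ?B"] by simp
  ultimately show ?thesis
    using measure_change by simp
qed

lemma ent_Suc:
  "mean.ent (Suc n) \<tau> F =
    (\<Sum>x=1..q. p n \<tau> x * mean.ent n (\<tau>(Suc n := x)) F)
    + site.ent n \<tau> (\<lambda>x. E n (\<tau>(Suc n := x)) F)"
  unfolding mean.ent_def site.ent_def E_Suc site.diff by simp

text \<open>Every value of the site has mass at least 1 / (q M). The variance is at most the mean
  square distance to any constant, so that constant may be \<open>g y\<close>, averaged over y; this
  produces the pairs handled by the comparison of roots.\<close>

lemma site_ent_square_le:
  assumes "n < N"
  shows "site.ent n \<tau> (\<lambda>x. (g x)\<^sup>2) \<le>
    4 * (real q * M) * (\<Sum>y=1..q. p n \<tau> y * (\<Sum>x=1..q. p n \<tau> x * (g x - g y)\<^sup>2))"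
proof -
  let ?S = "\<lambda>g. \<Sum>x=1..q. p n \<tau> x * g x"
  have qM: "1 \<le> real q * M"
    using q_pos M_ge_1 mult_mono[of 1 "real q" 1 M] by simp
  have "site.ent n \<tau> (\<lambda>x. (g x)\<^sup>2) \<le> 4 / (1 / (real q * M)) * ?S (\<lambda>x. (g x - ?S g)\<^sup>2)"
  proof (rule site.ent_square_le)
    fix F :: "nat \<Rightarrow> real" and x
    assume F: "\<And>y. y \<in> {1..q} \<Longrightarrow> 0 \<le> F y" and x: "x \<in> {1..q}"
    have "1 / (real q * M) * F x \<le> p n \<tau> x * F x"
      using F[OF x] p_ge[OF assms x] by (rule mult_right_mono[rotated])
    also have "\<dots> \<le> ?S F"
      using F x less_imp_le[OF p_pos] by (intro member_le_sum) auto
    finally show "1 / (real q * M) * F x \<le> ?S F" .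
  qed (use qM in auto)
  also have "\<dots> = 4 * (real q * M) * ?S (\<lambda>y. ?S (\<lambda>x. (g x - ?S g)\<^sup>2))"
    unfolding site.const by simp
  also have "\<dots> \<le> 4 * (real q * M) * ?S (\<lambda>y. ?S (\<lambda>x. (g x - g y)\<^sup>2))"
    using qM by (intro mult_left_mono site.mono site.variance_le) auto
  finally show ?thesis .
qed

text \<open>With c = q M, the site bound 4c multiplies 2c times the energy and 32/N times the
  entropy, which gives 8 c^2 and 128 c/N.\<close>

lemma ent_square_Suc_le:
  fixes f :: "(nat \<Rightarrow> nat) \<Rightarrow> real"
  assumes n: "n < N"
  defines "F \<equiv> \<lambda>\<eta>. (f \<eta>)\<^sup>2"
  shows "mean.ent (Suc n) \<tau> F \<le>
    (1 + 128 * (real q * M) / real N) * (\<Sum>x=1..q. p n \<tau> x * mean.ent n (\<tau>(Suc n := x)) F)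
    + 8 * (real q * M)\<^sup>2 * E (Suc n) \<tau> (local_energy (Suc n) f)"
proof -
  let ?S = "\<lambda>g. \<Sum>x=1..q. p n \<tau> x * g x" and ?i = "Suc n" and ?c = "real q * M"
  let ?X = "\<lambda>x y. E n (\<tau>(Suc n := x)) (\<lambda>\<eta>. (f \<eta> - f (\<eta>(Suc n := y)))\<^sup>2)"
  let ?e = "\<lambda>x. mean.ent n (\<tau>(Suc n := x)) F"
  define g where "g x = sqrt (E n (\<tau>(Suc n := x)) F)" for x
  have i: "?i \<in> {1..N}"
    using n by simp
  have c: "0 < ?c"
    using q_pos M_ge_1 by simp
  have g: "E n (\<tau>(Suc n := x)) F = (g x)\<^sup>2" for x
    unfolding g_def by (subst real_sqrt_pow2) (auto intro: mean.nonneg simp: F_def)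
  have energy: "?S (\<lambda>y. ?S (\<lambda>x. ?X x y)) \<le> ?c * E (Suc n) \<tau> (local_energy ?i f)"
  proof -
    have p_le: "p n \<tau> y \<le> 1" if "y \<in> {1..q}" for y
      using that member_le_sum[of y "{1..q}" "p n \<tau>"] less_imp_le[OF p_pos] sum_p by force
    have "?S (\<lambda>y. ?S (\<lambda>x. ?X x y)) = ?S (\<lambda>x. \<Sum>y=1..q. p n \<tau> y * ?X x y)"
      unfolding sum_distrib_left by (subst sum.swap) (simp add: mult.left_commute)
    also have "\<dots> \<le> ?S (\<lambda>x. E n (\<tau>(?i := x)) (\<lambda>\<eta>. ?c * local_energy ?i f \<eta>))"
    proof (rule site.mono)
      fix x
      have "(\<Sum>y=1..q. p n \<tau> y * ?X x y) =
          E n (\<tau>(?i := x)) (\<lambda>\<eta>. \<Sum>y=1..q. p n \<tau> y * (f \<eta> - f (\<eta>(?i := y)))\<^sup>2)"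
        by (simp add: mean.sum mean.scale)
      also have "\<dots> \<le> E n (\<tau>(?i := x)) (\<lambda>\<eta>. ?c * local_energy ?i f \<eta>)"
        unfolding local_energy_def sum_distrib_left
      proof (intro mean.mono sum_mono)
        fix \<eta> y assume y: "y \<in> {1..q}"
        \<comment> \<open>The averaged law of the site is exchanged for the conditional law at
          \<eta>: the former is at most 1, the latter at least 1/c.\<close>
        have "p n \<tau> y \<le> ?c * cond_prob ?i \<eta> y"
          using p_le[OF y] cond_prob_ge[OF i y, of \<eta>] c by (simp add: field_simps)
        then show "p n \<tau> y * (f \<eta> - f (\<eta>(?i := y)))\<^sup>2 \<le>
            ?c * (cond_prob ?i \<eta> y * (f \<eta> - f (\<eta>(?i := y)))\<^sup>2)"
          unfolding mult.assoc[symmetric] by (rule mult_right_mono) simp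
      qed
      finally show "(\<Sum>y=1..q. p n \<tau> y * ?X x y) \<le>
          E n (\<tau>(?i := x)) (\<lambda>\<eta>. ?c * local_energy ?i f \<eta>)" .
    qed
    also have "\<dots> = ?c * E (Suc n) \<tau> (local_energy ?i f)"
      by (simp only: E_Suc mean.scale site.scale)
    finally show ?thesis .
  qed
  have "?S (\<lambda>y. ?S (\<lambda>x. (g x - g y)\<^sup>2)) \<le> ?S (\<lambda>y. ?S (\<lambda>x. 2 * ?X x y + 32 / real N * ?e y))"
    unfolding g_def F_def by (intro site.mono mean_sqrt_change_le[OF n])
  also have "\<dots> = 2 * ?S (\<lambda>y. ?S (\<lambda>x. ?X x y)) + 32 / real N * ?S ?e"
    by (simp only: site.add site.scale site.const)
  also have "\<dots> \<le> 2 * (?c * E (Suc n) \<tau> (local_energy ?i f)) + 32 / real N * ?S ?e"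
    by (intro add_right_mono mult_left_mono energy) simp
  finally have "?S (\<lambda>y. ?S (\<lambda>x. (g x - g y)\<^sup>2)) \<le>
      2 * (?c * E (Suc n) \<tau> (local_energy ?i f)) + 32 / real N * ?S ?e" .
  then have "4 * ?c * ?S (\<lambda>y. ?S (\<lambda>x. (g x - g y)\<^sup>2)) \<le>
      4 * ?c * (2 * (?c * E (Suc n) \<tau> (local_energy ?i f)) + 32 / real N * ?S ?e)"
    using c by (intro mult_left_mono) auto
  then have "mean.ent (Suc n) \<tau> F \<le>
      ?S ?e + 4 * ?c * (2 * (?c * E (Suc n) \<tau> (local_energy ?i f)) + 32 / real N * ?S ?e)"
    unfolding ent_Suc g using site_ent_square_le[OF n, of \<tau> g] by linarith
  also have "\<dots> = (1 + 128 * ?c / real N) * ?S ?e + 8 * ?c\<^sup>2 * E (Suc n) \<tau> (local_energy ?i f)"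
    by (simp add: algebra_simps power2_eq_square)
  finally show ?thesis .
qed

lemma local_energy_nonneg: "0 \<le> local_energy i f \<eta>"
  unfolding local_energy_def using less_imp_le[OF cond_prob_pos]
  by (intro sum_nonneg mult_nonneg_nonneg) auto

lemma ent_square_le_power:
  assumes "n \<le> N"
  defines "k \<equiv> 1 + 128 * (real q * M) / real N"
  shows "mean.ent n \<tau> (\<lambda>\<eta>. (f \<eta>)\<^sup>2) \<le>
    8 * (real q * M)\<^sup>2 * k ^ n * (\<Sum>j=1..n. E n \<tau> (local_energy j f))"
  using assms(1)
proof (induction n arbitrary: \<tau>)
  case 0
  show ?case
    unfolding mean.ent_def by (simp add: E_0)
next
  case (Suc n)
  let ?S = "\<lambda>g. \<Sum>x=1..q. p n \<tau> x * g x" and ?c = "8 * (real q * M)\<^sup>2"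
  let ?L = "E (Suc n) \<tau> (local_energy (Suc n) f)"
  have k: "1 \<le> k"
    using M_ge_1 by (simp add: k_def)
  have L: "0 \<le> ?L"
    using local_energy_nonneg by (intro mean.nonneg)
  have "mean.ent (Suc n) \<tau> (\<lambda>\<eta>. (f \<eta>)\<^sup>2) \<le>
      k * ?S (\<lambda>x. mean.ent n (\<tau>(Suc n := x)) (\<lambda>\<eta>. (f \<eta>)\<^sup>2)) + ?c * ?L"
    unfolding k_def using Suc.prems by (intro ent_square_Suc_le) simp
  \<comment> \<open>The new energy term is enlarged by a power of k, at least 1, so that all
    energies share one factor.\<close>
  also have "\<dots> \<le> k * ?S (\<lambda>x. ?c * k ^ n * (\<Sum>j=1..n. E n (\<tau>(Suc n := x)) (local_energy j f)))
      + ?c * (k ^ Suc n * ?L)"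
    using Suc k L mult_right_mono[OF one_le_power[OF k, of "Suc n"] L]
    by (intro add_mono mult_left_mono site.mono) auto
  also have "\<dots> = ?c * k ^ Suc n * (?S (\<lambda>x. \<Sum>j=1..n. E n (\<tau>(Suc n := x)) (local_energy j f)) + ?L)"
    unfolding site.scale by (simp add: algebra_simps)
  also have "?S (\<lambda>x. \<Sum>j=1..n. E n (\<tau>(Suc n := x)) (local_energy j f)) =
      (\<Sum>j=1..n. E (Suc n) \<tau> (local_energy j f))"
    unfolding E_Suc sum_distrib_left by (rule sum.swap)
  finally show ?case
    by simp
qed

lemma log_sobolev:
  "mean.ent N \<tau> (\<lambda>\<eta>. (f \<eta>)\<^sup>2) \<le>
    8 * (real q * M)\<^sup>2 * exp (128 * (real q * M)) * (\<Sum>j=1..N. E N \<tau> (local_energy j f))"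
proof -
  have "0 \<le> (\<Sum>j=1..N. E N \<tau> (local_energy j f))"
    using local_energy_nonneg by (intro sum_nonneg mean.nonneg)
  moreover have "(1 + 128 * (real q * M) / real N) ^ N \<le> exp (128 * (real q * M))"
  proof (cases "N = 0")
    case False
    have "0 \<le> real q * M"
      using M_ge_1 by simp
    then show ?thesis
      using False by (intro exp_ge_one_plus_x_over_n_power_n) auto
  qed (use M_ge_1 in simp)
  ultimately have "8 * (real q * M)\<^sup>2 * (1 + 128 * (real q * M) / real N) ^ N *
        (\<Sum>j=1..N. E N \<tau> (local_energy j f)) \<le>
      8 * (real q * M)\<^sup>2 * exp (128 * (real q * M)) * (\<Sum>j=1..N. E N \<tau> (local_energy j f))"
    by (intro mult_right_mono mult_left_mono) auto
  then show ?thesis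
    using ent_square_le_power[of N \<tau> f] by simp
qed

subsection \<open>Modified logarithmic Sobolev inequalities\<close>

text \<open>Invariance of the Gibbs measure under a heat-bath step at i. The conditional average
  \<open>A\<close> does not depend on site i, so W A and W F have equal sums over the value at i;
  the factor q from introducing this sum cancels.\<close>

lemma mean_resample:
  assumes "i \<in> {1..N}"
  shows "E N \<tau> (\<lambda>\<eta>. \<Sum>x=1..q. cond_prob i \<eta> x * F (\<eta>(i := x))) = E N \<tau> F"
proof -
  define A where "A \<eta> = (\<Sum>x=1..q. cond_prob i \<eta> x * F (\<eta>(i := x)))" for \<eta>
  have A_upd: "A (\<eta>(i := z)) = A \<eta>" for \<eta> z
    unfolding A_def cond_prob_upd fun_upd_upd ..
  have "(\<Sum>z=1..q. W (\<eta>(i := z)) * A (\<eta>(i := z))) =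
      (\<Sum>z=1..q. W (\<eta>(i := z)) * F (\<eta>(i := z)))" for \<eta>
  proof -
    have "(\<Sum>z=1..q. W (\<eta>(i := z)) * A (\<eta>(i := z))) = (\<Sum>z=1..q. W (\<eta>(i := z))) * A \<eta>"
      unfolding A_upd sum_distrib_right ..
    also have "\<dots> = (\<Sum>x=1..q. (\<Sum>z=1..q. W (\<eta>(i := z))) * (cond_prob i \<eta> x * F (\<eta>(i := x))))"
      unfolding A_def sum_distrib_left ..
    also have "\<dots> = (\<Sum>x=1..q. W (\<eta>(i := x)) * F (\<eta>(i := x)))"
      using sum_W_pos[of \<eta> i] by (intro sum.cong refl) (simp add: cond_prob_def)
    finally show ?thesis .
  qed
  then have "real q * site_sum q N (\<lambda>\<eta>. W \<eta> * A \<eta>) \<tau> =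
      real q * site_sum q N (\<lambda>\<eta>. W \<eta> * F \<eta>) \<tau>"
    using site_sum_resample[OF assms, of q "\<lambda>\<eta>. W \<eta> * A \<eta>" \<tau>]
      site_sum_resample[OF assms, of q "\<lambda>\<eta>. W \<eta> * F \<eta>" \<tau>] by (simp only:)
  then show ?thesis
    using q_pos by (simp add: E_def A_def)
qed

text \<open>After resampling, the old and the new value at i are independent with the same
  conditional law, hence exchangeable.\<close>

lemma mean_resample_pairs:
  assumes "i \<in> {1..N}"
  shows "E N \<tau> (\<lambda>\<eta>. \<Sum>y=1..q. cond_prob i \<eta> y * h (f \<eta>) (f (\<eta>(i := y)))) =
    E N \<tau> (\<lambda>\<eta>. \<Sum>x=1..q. cond_prob i \<eta> x *
      (\<Sum>y=1..q. cond_prob i \<eta> y * h (f (\<eta>(i := x))) (f (\<eta>(i := y)))))"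
  using mean_resample[OF assms, of \<tau>
      "\<lambda>\<eta>. \<Sum>y=1..q. cond_prob i \<eta> y * h (f \<eta>) (f (\<eta>(i := y)))"]
  by (simp only: cond_prob_upd fun_upd_upd)

lemma mean_local_energy_exp_le_covariance:
  assumes "i \<in> {1..N}"
  shows "E N \<tau> (local_energy i (\<lambda>\<eta>. exp (f \<eta> / 2))) \<le>
    E N \<tau> (\<lambda>\<eta>. (\<Sum>x=1..q. cond_prob i \<eta> x * (f (\<eta>(i := x)) * exp (f (\<eta>(i := x)))))
      - (\<Sum>x=1..q. cond_prob i \<eta> x * f (\<eta>(i := x)))
        * (\<Sum>x=1..q. cond_prob i \<eta> x * exp (f (\<eta>(i := x)))))"
proof -
  have half: "1 / 2 * (2 * c) = c" for c :: real
    by simp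
  have "E N \<tau> (local_energy i (\<lambda>\<eta>. exp (f \<eta> / 2))) =
      E N \<tau> (\<lambda>\<eta>. \<Sum>x=1..q. cond_prob i \<eta> x * (\<Sum>y=1..q. cond_prob i \<eta> y *
        (exp (f (\<eta>(i := x)) / 2) - exp (f (\<eta>(i := y)) / 2))\<^sup>2))"
    unfolding local_energy_def
    by (rule mean_resample_pairs[OF assms, where h = "\<lambda>a b. (exp (a / 2) - exp (b / 2))\<^sup>2"])
  also have "\<dots> \<le> E N \<tau> (\<lambda>\<eta>. \<Sum>x=1..q. cond_prob i \<eta> x * (\<Sum>y=1..q. cond_prob i \<eta> y * (1 / 2 *
      ((f (\<eta>(i := x)) - f (\<eta>(i := y))) * (exp (f (\<eta>(i := x))) - exp (f (\<eta>(i := y))))))))"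
    by (intro mean.mono cond.mono exp_half_diff_sq_le_covariance)
  finally show ?thesis
    unfolding cond.scale cond.mean_diff_mult_diff half .
qed

text \<open>Both halves of the symmetric pointwise bound have the same average over the exchangeable
  pair, so 1/4 becomes 1/2; the resampling is then undone.\<close>

lemma mean_local_energy_exp_le_energy:
  assumes "i \<in> {1..N}"
  shows "E N \<tau> (local_energy i (\<lambda>\<eta>. exp (f \<eta> / 2))) \<le>
    1 / 2 * E N \<tau> (\<lambda>\<eta>. local_energy i f \<eta> * exp (f \<eta>))"
proof -
  let ?k = "\<lambda>a b. (a - b)\<^sup>2 * exp a :: real"
  have "E N \<tau> (local_energy i (\<lambda>\<eta>. exp (f \<eta> / 2))) =
      E N \<tau> (\<lambda>\<eta>. \<Sum>x=1..q. cond_prob i \<eta> x * (\<Sum>y=1..q. cond_prob i \<eta> y *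
        (exp (f (\<eta>(i := x)) / 2) - exp (f (\<eta>(i := y)) / 2))\<^sup>2))"
    unfolding local_energy_def
    by (rule mean_resample_pairs[OF assms, where h = "\<lambda>a b. (exp (a / 2) - exp (b / 2))\<^sup>2"])
  also have "\<dots> \<le> E N \<tau> (\<lambda>\<eta>. \<Sum>x=1..q. cond_prob i \<eta> x * (\<Sum>y=1..q. cond_prob i \<eta> y *
      (1 / 4 * (?k (f (\<eta>(i := x))) (f (\<eta>(i := y))) + ?k (f (\<eta>(i := y))) (f (\<eta>(i := x)))))))"
    by (intro mean.mono cond.mono exp_half_diff_sq_le_energy)
  also have "\<dots> = 1 / 2 * E N \<tau> (\<lambda>\<eta>. \<Sum>x=1..q. cond_prob i \<eta> x * (\<Sum>y=1..q. cond_prob i \<eta> y *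
      ?k (f (\<eta>(i := x))) (f (\<eta>(i := y)))))"
  proof -
    have "(\<Sum>x=1..q. cond_prob i \<eta> x * (\<Sum>y=1..q. cond_prob i \<eta> y *
          ?k (f (\<eta>(i := y))) (f (\<eta>(i := x))))) =
        (\<Sum>x=1..q. cond_prob i \<eta> x * (\<Sum>y=1..q. cond_prob i \<eta> y *
          ?k (f (\<eta>(i := x))) (f (\<eta>(i := y)))))" for \<eta>
      unfolding sum_distrib_left by (subst sum.swap) (simp add: mult.left_commute)
    then show ?thesis
      unfolding cond.scale cond.add mean.scale mean.add by simp
  qed
  also have "\<dots> = 1 / 2 * E N \<tau> (\<lambda>\<eta>. \<Sum>y=1..q. cond_prob i \<eta> y * ?k (f \<eta>) (f (\<eta>(i := y))))"
    by (subst mean_resample_pairs[OF assms, where h = ?k]) simp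
  finally show ?thesis
    by (simp add: local_energy_def sum_distrib_right mult.assoc)
qed

lemma ent_exp_le:
  "mean.ent N \<tau> (\<lambda>\<eta>. exp (f \<eta>)) \<le>
    8 * (real q * M)\<^sup>2 * exp (128 * (real q * M)) *
      (\<Sum>j=1..N. E N \<tau> (local_energy j (\<lambda>\<eta>. exp (f \<eta> / 2))))"
proof -
  have "(\<lambda>\<eta>. exp (f \<eta>)) = (\<lambda>\<eta>. (exp (f \<eta> / 2))\<^sup>2)"
    by (simp flip: exp_double)
  then show ?thesis
    using log_sobolev[of \<tau> "\<lambda>\<eta>. exp (f \<eta> / 2)"] by (simp only:)
qed

end

section \<open>The block spin Potts model\<close>

lemma site_sum_configs: "(\<Sum>\<eta>\<in>configs n q. F \<eta>) = site_sum q n F (\<lambda>_. undefined)"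
proof -
  have "(\<Sum>\<eta>\<in>{1..n} \<rightarrow>\<^sub>E {1..q}. F (override_on \<tau> \<eta> {1..n})) = site_sum q n F \<tau>" for \<tau>
  proof (induction n arbitrary: \<tau>)
    case 0
    then show ?case
      by simp
  next
    case (Suc n)
    have ins: "{1..Suc n} = insert (Suc n) {1..n}"
      by auto
    have inj: "inj_on (\<lambda>(y, g). g(Suc n := y)) ({1..q} \<times> ({1..n} \<rightarrow>\<^sub>E {1..q}))"
      by (rule inj_combinator) simp
    have "(\<Sum>\<eta>\<in>{1..Suc n} \<rightarrow>\<^sub>E {1..q}. F (override_on \<tau> \<eta> {1..Suc n})) =
        (\<Sum>(x, \<eta>)\<in>{1..q} \<times> ({1..n} \<rightarrow>\<^sub>E {1..q}).
          F (override_on \<tau> (\<eta>(Suc n := x)) {1..Suc n}))"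
      unfolding ins PiE_insert_eq using inj
      by (subst sum.reindex) (auto simp: case_prod_unfold comp_def)
    also have "\<dots> = (\<Sum>x=1..q. \<Sum>\<eta>\<in>{1..n} \<rightarrow>\<^sub>E {1..q}.
        F (override_on (\<tau>(Suc n := x)) \<eta> {1..n}))"
    proof -
      have "override_on \<tau> (\<eta>(Suc n := x)) {1..Suc n} = override_on (\<tau>(Suc n := x)) \<eta> {1..n}" for \<eta> x
        by (auto simp: override_on_def fun_eq_iff)
      then show ?thesis
        by (simp only: sum.cartesian_product)
    qed
    also have "\<dots> = site_sum q (Suc n) F \<tau>"
      by (simp only: Suc.IH site_sum.simps)
    finally show ?case .
  qed
  moreover have "override_on (\<lambda>_. undefined) \<eta> {1..n} = \<eta>" if "\<eta> \<in> {1..n} \<rightarrow>\<^sub>E {1..q}" for \<eta>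
    using that by (auto simp: override_on_def fun_eq_iff PiE_def extensional_def)
  then have "(\<Sum>\<eta>\<in>configs n q. F \<eta>) =
      (\<Sum>\<eta>\<in>{1..n} \<rightarrow>\<^sub>E {1..q}. F (override_on (\<lambda>_. undefined) \<eta> {1..n}))"
    unfolding configs_def by (intro sum.cong refl) simp
  ultimately show ?thesis
    by (simp only:)
qed

definition gibbs_weight ::
    "real \<Rightarrow> real \<Rightarrow> nat \<Rightarrow> (nat \<Rightarrow> nat set) \<Rightarrow> nat \<Rightarrow> (nat \<Rightarrow> nat) \<Rightarrow> real" where
  "gibbs_weight \<beta> \<alpha> s P N \<eta> = exp (- hamiltonian \<beta> \<alpha> s P N \<eta>)"

definition coupling :: "real \<Rightarrow> real \<Rightarrow> nat \<Rightarrow> (nat \<Rightarrow> nat set) \<Rightarrow> nat \<Rightarrow> nat \<Rightarrow> real" where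
  "coupling \<beta> \<alpha> s P i j = (if same_block s P i j then \<beta> else \<alpha>)"

text \<open>The part of the negative energy that depends on the spin x at site i. The denominator is
  N and not 2N because ordered pairs count each neighbour twice; the pair (i, i) contributes a
  constant.\<close>

definition local_field ::
    "real \<Rightarrow> real \<Rightarrow> nat \<Rightarrow> (nat \<Rightarrow> nat set) \<Rightarrow> nat \<Rightarrow> nat \<Rightarrow> (nat \<Rightarrow> nat) \<Rightarrow> nat \<Rightarrow> real" where
  "local_field \<beta> \<alpha> s P N i \<eta> x =
    (\<Sum>j\<in>{1..N} - {i}. coupling \<beta> \<alpha> s P i j * of_bool (x = \<eta> j)) / real N"

lemma coupling_commute: "coupling \<beta> \<alpha> s P i j = coupling \<beta> \<alpha> s P j i"
  by (auto simp: coupling_def same_block_def)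

lemma hamiltonian_eq_coupling:
  "- hamiltonian \<beta> \<alpha> s P N \<eta> =
    (\<Sum>i=1..N. \<Sum>j=1..N. coupling \<beta> \<alpha> s P i j * of_bool (\<eta> i = \<eta> j)) / (2 * real N)"
proof -
  let ?I = "{1..N} \<times> {1..N}"
  let ?f = "\<lambda>(i, j). of_bool (\<eta> i = \<eta> j) :: real"
  have "(\<Sum>i=1..N. \<Sum>j=1..N. coupling \<beta> \<alpha> s P i j * of_bool (\<eta> i = \<eta> j)) =
      (\<Sum>z\<in>?I. if (case z of (i, j) \<Rightarrow> same_block s P i j) then \<beta> * ?f z else \<alpha> * ?f z)"
    unfolding sum.cartesian_product by (intro sum.cong) (auto simp: coupling_def)
  also have "\<dots> = \<beta> * sum ?f {(i, j) \<in> ?I. same_block s P i j}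
      + \<alpha> * sum ?f {(i, j) \<in> ?I. \<not> same_block s P i j}"
    by (subst sum.If_cases)
      (auto simp: sum_distrib_left intro!: arg_cong2[where f = "(+)"] sum.cong)
  finally show ?thesis
    by (simp add: hamiltonian_def add_divide_distrib)
qed

lemma hamiltonian_upd:
  assumes "i \<in> {1..N}"
  shows "\<exists>c. \<forall>x. - hamiltonian \<beta> \<alpha> s P N (\<eta>(i := x)) = c + local_field \<beta> \<alpha> s P N i \<eta> x"
proof (intro exI allI)
  fix x
  let ?a = "coupling \<beta> \<alpha> s P" and ?R = "{1..N} - {i}"
  let ?d = "(\<Sum>k\<in>?R. \<Sum>l\<in>?R. ?a k l * of_bool (\<eta> k = \<eta> l))"
  have split: "(\<Sum>k=1..N. g k) = g i + (\<Sum>k\<in>?R. g k)" for g :: "nat \<Rightarrow> real"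
    using assms by (intro sum.remove) auto
  have "(\<Sum>k=1..N. \<Sum>l=1..N. ?a k l * of_bool ((\<eta>(i := x)) k = (\<eta>(i := x)) l)) =
      ?a i i + (\<Sum>l\<in>?R. ?a i l * of_bool (x = \<eta> l))
      + ((\<Sum>k\<in>?R. ?a k i * of_bool (\<eta> k = x)) + ?d)"
    unfolding split by (simp add: sum.distrib)
  also have "(\<Sum>k\<in>?R. ?a k i * of_bool (\<eta> k = x)) = (\<Sum>l\<in>?R. ?a i l * of_bool (x = \<eta> l))"
    by (intro sum.cong) (auto simp: coupling_commute)
  finally show "- hamiltonian \<beta> \<alpha> s P N (\<eta>(i := x)) =
      (?a i i + ?d) / (2 * real N) + local_field \<beta> \<alpha> s P N i \<eta> x"
    by (simp add: hamiltonian_eq_coupling local_field_def add_divide_distrib)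
qed

lemma local_field_bounds:
  assumes "0 < \<alpha>" "\<alpha> < \<beta>"
  shows "0 \<le> local_field \<beta> \<alpha> s P N i \<eta> x" "local_field \<beta> \<alpha> s P N i \<eta> x \<le> \<beta>"
proof -
  have a: "0 \<le> coupling \<beta> \<alpha> s P i j * of_bool (x = \<eta> j)"
    "coupling \<beta> \<alpha> s P i j * of_bool (x = \<eta> j) \<le> \<beta>" for j
    using assms by (auto simp: coupling_def)
  then show "0 \<le> local_field \<beta> \<alpha> s P N i \<eta> x"
    unfolding local_field_def by (intro divide_nonneg_nonneg sum_nonneg) auto
  have "(\<Sum>j\<in>{1..N} - {i}. coupling \<beta> \<alpha> s P i j * of_bool (x = \<eta> j)) \<le>
      (\<Sum>j=1..N. coupling \<beta> \<alpha> s P i j * of_bool (x = \<eta> j))"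
    using a by (intro sum_mono2) auto
  also have "\<dots> \<le> real N * \<beta>"
    using sum_bounded_above[of "{1..N}" "\<lambda>j. coupling \<beta> \<alpha> s P i j * of_bool (x = \<eta> j)" \<beta>] a
    by simp
  finally show "local_field \<beta> \<alpha> s P N i \<eta> x \<le> \<beta>"
    using assms by (cases "N = 0") (simp_all add: local_field_def field_simps)
qed

lemma local_field_diff_le:
  assumes "0 < \<alpha>" "\<alpha> < \<beta>"
  shows "local_field \<beta> \<alpha> s P N i (\<eta>(j := z)) x - local_field \<beta> \<alpha> s P N i (\<eta>(j := z')) x \<le> \<beta> / real N"
proof -
  let ?t = "\<lambda>z k. coupling \<beta> \<alpha> s P i k * of_bool (x = (\<eta>(j := z)) k) :: real"
  have "(\<Sum>k\<in>{1..N} - {i}. ?t z k) - (\<Sum>k\<in>{1..N} - {i}. ?t z' k) =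
      (\<Sum>k\<in>{1..N} - {i}. ?t z k - ?t z' k)"
    by (simp add: sum_subtractf)
  also have "\<dots> \<le> (\<Sum>k\<in>{1..N} - {i}. if k = j then \<beta> else 0)"
    using assms by (intro sum_mono) (auto simp: coupling_def)
  also have "\<dots> \<le> \<beta>"
    using assms by (subst sum.delta) auto
  finally show ?thesis
    by (simp add: local_field_def divide_right_mono flip: diff_divide_distrib)
qed

lemma gibbs_weight_ratio_le:
  assumes "0 < \<alpha>" "\<alpha> < \<beta>" "i \<in> {1..N}"
  shows "gibbs_weight \<beta> \<alpha> s P N (\<eta>(i := x)) \<le> exp \<beta> * gibbs_weight \<beta> \<alpha> s P N (\<eta>(i := y))"
proof -
  obtain c where "\<And>x. - hamiltonian \<beta> \<alpha> s P N (\<eta>(i := x)) = c + local_field \<beta> \<alpha> s P N i \<eta> x"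
    using hamiltonian_upd[OF assms(3)] by metis
  then show ?thesis
    using local_field_bounds[OF assms(1,2), of s P N i \<eta> x]
      local_field_bounds[OF assms(1,2), of s P N i \<eta> y]
    by (simp add: gibbs_weight_def flip: exp_add)
qed

text \<open>The part of the energy independent of the spin at i depends on z alone and cancels in
  the cross ratio. What remains are two differences of local fields, each at most \<beta> / N since
  only site j changes.\<close>

lemma gibbs_weight_mixed_le:
  assumes "0 < \<alpha>" "\<alpha> < \<beta>" "i \<in> {1..N}" "i \<noteq> j"
  shows "gibbs_weight \<beta> \<alpha> s P N (\<eta>(i := x, j := z)) * gibbs_weight \<beta> \<alpha> s P N (\<eta>(i := y, j := z')) \<le>
    exp (2 * \<beta> / real N) *
      (gibbs_weight \<beta> \<alpha> s P N (\<eta>(i := y, j := z)) * gibbs_weight \<beta> \<alpha> s P N (\<eta>(i := x, j := z')))"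
proof -
  have "\<forall>z. \<exists>c. \<forall>x. - hamiltonian \<beta> \<alpha> s P N (\<eta>(j := z, i := x)) =
      c + local_field \<beta> \<alpha> s P N i (\<eta>(j := z)) x"
    using hamiltonian_upd[OF assms(3)] by blast
  then obtain c where "\<And>z x. - hamiltonian \<beta> \<alpha> s P N (\<eta>(j := z, i := x)) =
      c z + local_field \<beta> \<alpha> s P N i (\<eta>(j := z)) x"
    by metis
  then have c: "- hamiltonian \<beta> \<alpha> s P N (\<eta>(i := x, j := z)) =
      c z + local_field \<beta> \<alpha> s P N i (\<eta>(j := z)) x" for x z
    by (metis assms(4) fun_upd_twist)
  have "2 * \<beta> / real N = \<beta> / real N + \<beta> / real N"
    by simp
  then show ?thesis
    unfolding gibbs_weight_def exp_add[symmetric] c exp_le_cancel_iff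
    using local_field_diff_le[OF assms(1,2), of s P N i \<eta> j z x z']
      local_field_diff_le[OF assms(1,2), of s P N i \<eta> j z' y z]
    by linarith
qed

text \<open>From q >= 3 and e^\<beta> >= 1 follows 6 \<beta> <= 1. With e^t - 1 <= t e^t the left
  side is at most 2 \<beta> e^(4 \<beta>) <= (1/3) * 3, because 4 \<beta> <= 1 and e <= 3.\<close>

lemma high_temperature_small:
  fixes q N :: nat and \<beta> :: real
  assumes "3 \<le> q" "0 < \<beta>" "2 * real q * \<beta> * exp \<beta> < 1" "0 < N"
  shows "real N * (exp (2 * \<beta> / real N) - 1) * (exp \<beta>)\<^sup>2 \<le> 1"
proof -
  let ?t = "2 * \<beta> / real N"
  have "6 * \<beta> * 1 \<le> 2 * real q * \<beta> * exp \<beta>"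
    using assms by (intro mult_mono) auto
  then have \<beta>: "6 * \<beta> \<le> 1"
    using assms(3) by linarith
  have t: "0 \<le> ?t" "?t \<le> 2 * \<beta>"
    using assms by (auto simp: field_simps)
  have "exp ?t * (1 + (- ?t)) \<le> exp ?t * exp (- ?t)"
    by (intro mult_left_mono exp_ge_add_one_self) simp
  then have "exp ?t - 1 \<le> ?t * exp ?t"
    by (simp add: exp_minus algebra_simps)
  also have "\<dots> \<le> ?t * exp (2 * \<beta>)"
    using t by (intro mult_left_mono) auto
  finally have "real N * (exp ?t - 1) \<le> 2 * \<beta> * exp (2 * \<beta>)"
    using assms by (simp add: field_simps)
  then have "real N * (exp ?t - 1) * (exp \<beta>)\<^sup>2 \<le> 2 * \<beta> * exp (2 * \<beta>) * (exp \<beta>)\<^sup>2"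
    by (rule mult_right_mono) simp
  also have "\<dots> = 2 * \<beta> * exp (4 * \<beta>)"
    by (simp flip: exp_double exp_add)
  also have "\<dots> \<le> 1 / 3 * 3"
  proof (rule mult_mono)
    have "exp (4 * \<beta>) \<le> exp 1"
      using \<beta> assms by simp
    then show "exp (4 * \<beta>) \<le> 3"
      using exp_le by linarith
  qed (use \<beta> in auto)
  finally show ?thesis
    by simp
qed

lemma spin_system_gibbs_weight:
  assumes "3 \<le> q" "0 < \<alpha>" "\<alpha> < \<beta>" "2 * real q * \<beta> * exp \<beta> < 1" "0 < N"
  shows "spin_system N q (gibbs_weight \<beta> \<alpha> s P N) (exp \<beta>) (exp (2 * \<beta> / real N) - 1)"
proof
  show "real N * (exp (2 * \<beta> / real N) - 1) * (exp \<beta>)\<^sup>2 \<le> 1"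
    using assms by (intro high_temperature_small[of q]) auto
  show "gibbs_weight \<beta> \<alpha> s P N (\<eta>(i := x, j := z)) * gibbs_weight \<beta> \<alpha> s P N (\<eta>(i := y, j := z')) \<le>
      (1 + (exp (2 * \<beta> / real N) - 1)) *
      (gibbs_weight \<beta> \<alpha> s P N (\<eta>(i := y, j := z)) * gibbs_weight \<beta> \<alpha> s P N (\<eta>(i := x, j := z')))"
    if "i \<in> {1..N}" "i \<noteq> j" for i j x y z z' \<eta>
    using gibbs_weight_mixed_le[OF assms(2,3) that] by simp
qed (use assms gibbs_weight_ratio_le in \<open>auto simp: gibbs_weight_def\<close>)

section \<open>Expectations and single-site conditional laws as finite sums\<close>

lemma expectation_gibbs:
  assumes "0 < q"
  shows "measure_pmf.expectation (gibbs q \<beta> \<alpha> s P N) F =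
    (\<Sum>\<eta>\<in>configs N q. gibbs_weight \<beta> \<alpha> s P N \<eta> * F \<eta>) / (\<Sum>\<eta>\<in>configs N q. gibbs_weight \<beta> \<alpha> s P N \<eta>)"
proof -
  have "measure_pmf.expectation (gibbs q \<beta> \<alpha> s P N) F =
      (\<Sum>\<eta>\<in>configs N q. F \<eta> * pmf (gibbs q \<beta> \<alpha> s P N) \<eta>)"
    using finite_configs set_pmf_gibbs[OF assms] by (intro integral_measure_pmf_real) auto
  then show ?thesis
    by (simp add: pmf_gibbs[OF assms] partition_fun_def gibbs_weight_def sum_divide_distrib mult.commute)
qed

lemma expectation_gibbs_cong:
  fixes F G :: "(nat \<Rightarrow> nat) \<Rightarrow> real"
  assumes "0 < q" "\<And>\<eta>. \<eta> \<in> configs N q \<Longrightarrow> F \<eta> = G \<eta>"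
  shows "measure_pmf.expectation (gibbs q \<beta> \<alpha> s P N) F = measure_pmf.expectation (gibbs q \<beta> \<alpha> s P N) G"
  unfolding expectation_gibbs[OF assms(1)] using assms(2)
  by (intro arg_cong2[where f = "(/)"] sum.cong) auto

lemma configs_upd:
  assumes "\<eta> \<in> configs N q" "i \<in> {1..N}" "x \<in> {1..q}"
  shows "\<eta>(i := x) \<in> configs N q"
  using assms by (auto simp: configs_def PiE_iff extensional_def)

text \<open>The conditioning event meets the support in exactly the q configurations
  \<open>\<eta>(i := x)\<close>, and the partition function cancels from the quotient.\<close>

lemma expectation_cond_site:
  fixes \<alpha> \<beta> :: real and s :: nat and P :: "nat \<Rightarrow> nat set"
  assumes q: "0 < q" and \<eta>: "\<eta> \<in> configs N q" and i: "i \<in> {1..N}"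
  defines "W \<equiv> gibbs_weight \<beta> \<alpha> s P N"
  shows "measure_pmf.expectation (cond_site N (gibbs q \<beta> \<alpha> s P N) i \<eta>) g =
    (\<Sum>x=1..q. W (\<eta>(i := x)) / (\<Sum>z=1..q. W (\<eta>(i := z))) * g x)"
proof -
  let ?\<mu> = "gibbs q \<beta> \<alpha> s P N" and ?A = "{\<eta>'. \<forall>j\<in>{1..N} - {i}. \<eta>' j = \<eta> j}"
  let ?Z = "partition_fun q \<beta> \<alpha> s P N"
  have Z: "0 < ?Z"
    using q by (rule partition_fun_pos)
  have pmf: "pmf ?\<mu> (\<eta>(i := x)) = W (\<eta>(i := x)) / ?Z" if "x \<in> {1..q}" for x
    using configs_upd[OF \<eta> i that] by (simp add: pmf_gibbs[OF q] W_def gibbs_weight_def)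
  have inj: "inj_on (\<lambda>x. \<eta>(i := x)) {1..q}"
    by (rule inj_onI) (metis fun_upd_same)
  have support: "configs N q \<inter> ?A = (\<lambda>x. \<eta>(i := x)) ` {1..q}"
  proof (intro equalityI subsetI)
    fix \<eta>' assume \<eta>': "\<eta>' \<in> configs N q \<inter> ?A"
    have "\<eta>' j = (\<eta>(i := \<eta>' i)) j" for j
      using \<eta> \<eta>' by (cases "j \<in> {1..N}") (auto simp: configs_def PiE_iff extensional_def)
    moreover have "\<eta>' i \<in> {1..q}"
      using \<eta>' i by (auto simp: configs_def)
    ultimately show "\<eta>' \<in> (\<lambda>x. \<eta>(i := x)) ` {1..q}"
      by (intro image_eqI[of _ _ "\<eta>' i"] ext)
  next
    fix \<eta>' assume "\<eta>' \<in> (\<lambda>x. \<eta>(i := x)) ` {1..q}"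
    then show "\<eta>' \<in> configs N q \<inter> ?A"
      using configs_upd[OF \<eta> i] by (auto split: if_splits)
  qed
  have nonempty: "set_pmf ?\<mu> \<inter> ?A \<noteq> {}"
    using q \<eta> by (rule cond_site_event_nonempty)
  have "measure_pmf.prob ?\<mu> ?A = measure_pmf.prob ?\<mu> (configs N q \<inter> ?A)"
    using measure_Int_set_pmf[of ?\<mu> ?A] by (simp add: set_pmf_gibbs[OF q] Int_commute)
  also have "\<dots> = (\<Sum>z=1..q. pmf ?\<mu> (\<eta>(i := z)))"
    unfolding support using inj by (simp add: measure_measure_pmf_finite sum.reindex)
  also have "\<dots> = (\<Sum>z=1..q. W (\<eta>(i := z))) / ?Z"
    using pmf by (simp add: sum_divide_distrib)
  finally have prob: "measure_pmf.prob ?\<mu> ?A = (\<Sum>z=1..q. W (\<eta>(i := z))) / ?Z" .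
  have "measure_pmf.expectation (cond_site N ?\<mu> i \<eta>) g =
      measure_pmf.expectation (cond_pmf ?\<mu> ?A) (\<lambda>\<eta>'. g (\<eta>' i))"
    by (simp add: cond_site_def)
  also have "\<dots> = (\<Sum>\<eta>'\<in>configs N q \<inter> ?A. g (\<eta>' i) * pmf (cond_pmf ?\<mu> ?A) \<eta>')"
    using finite_configs set_cond_pmf[OF nonempty] set_pmf_gibbs[OF q]
    by (intro integral_measure_pmf_real) auto
  also have "\<dots> = (\<Sum>\<eta>'\<in>configs N q \<inter> ?A. g (\<eta>' i) * (pmf ?\<mu> \<eta>' / measure_pmf.prob ?\<mu> ?A))"
    by (intro sum.cong refl) (subst pmf_cond[OF nonempty], simp)
  also have "\<dots> = (\<Sum>x=1..q. g x * (pmf ?\<mu> (\<eta>(i := x)) / measure_pmf.prob ?\<mu> ?A))"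
    unfolding support using inj by (simp add: sum.reindex)
  also have "\<dots> = (\<Sum>x=1..q. W (\<eta>(i := x)) / (\<Sum>z=1..q. W (\<eta>(i := z))) * g x)"
    unfolding prob using Z pmf by (intro sum.cong) auto
  finally show ?thesis .
qed

section \<open>Transfer of the inequalities to the Gibbs measure\<close>

context
  fixes q N s :: nat and \<alpha> \<beta> :: real and P :: "nat \<Rightarrow> nat set"
  assumes q: "3 \<le> q" and \<alpha>: "0 < \<alpha>" "\<alpha> < \<beta>" and high_temp: "2 * real q * \<beta> * exp \<beta> < 1"
    and N: "0 < N"
begin

interpretation spin_system N q "gibbs_weight \<beta> \<alpha> s P N" "exp \<beta>" "exp (2 * \<beta> / real N) - 1"
  using q \<alpha> high_temp N by (rule spin_system_gibbs_weight)

abbreviation (input) "\<mu> \<equiv> gibbs q \<beta> \<alpha> s P N"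
abbreviation (input) "lsi_const \<equiv> 8 * (real q * exp \<beta>)\<^sup>2 * exp (128 * (real q * exp \<beta>))"

lemma expectation_eq_E: "measure_pmf.expectation \<mu> F = E N (\<lambda>_. undefined) F"
  using expectation_gibbs[of q] q by (simp add: site_sum_configs E_def)

lemma Ent_eq_ent: "Ent \<mu> F = mean.ent N (\<lambda>_. undefined) F"
  unfolding Ent_def mean.ent_def expectation_eq_E ..

lemma expectation_cond_site_eq:
  assumes "\<eta> \<in> configs N q" "i \<in> {1..N}"
  shows "measure_pmf.expectation (cond_site N \<mu> i \<eta>) g = (\<Sum>x=1..q. cond_prob i \<eta> x * g x)"
  unfolding cond_prob_def using q assms by (intro expectation_cond_site) auto

lemma diff_op_sq:
  assumes "\<eta> \<in> configs N q"
  shows "(diff_op N \<mu> f \<eta>)\<^sup>2 = (\<Sum>i=1..N. local_energy i f \<eta>)"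
proof -
  have "diff_op N \<mu> f \<eta> = sqrt (\<Sum>i=1..N. local_energy i f \<eta>)"
    unfolding diff_op_def local_energy_def
    using assms by (intro arg_cong[where f = sqrt] sum.cong expectation_cond_site_eq) auto
  then show ?thesis
    using local_energy_nonneg by (simp add: sum_nonneg)
qed

text \<open>The difference operator is identified with the local energies only on
  \<open>configs N q\<close>, where the conditional laws are computed; the expectation sees no other
  configuration.\<close>

lemma expectation_diff_op_sq_mult:
  "measure_pmf.expectation \<mu> (\<lambda>\<eta>. (diff_op N \<mu> f \<eta>)\<^sup>2 * g \<eta>) =
    (\<Sum>i=1..N. E N (\<lambda>_. undefined) (\<lambda>\<eta>. local_energy i f \<eta> * g \<eta>))"
proof -
  have "measure_pmf.expectation \<mu> (\<lambda>\<eta>. (diff_op N \<mu> f \<eta>)\<^sup>2 * g \<eta>) =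
      measure_pmf.expectation \<mu> (\<lambda>\<eta>. \<Sum>i=1..N. local_energy i f \<eta> * g \<eta>)"
    using q by (intro expectation_gibbs_cong) (auto simp: diff_op_sq sum_distrib_right)
  then show ?thesis
    unfolding expectation_eq_E by (simp add: mean.sum)
qed

lemma gibbs_log_sobolev:
  "Ent \<mu> (\<lambda>\<eta>. (f \<eta>)\<^sup>2) \<le>
    lsi_const * measure_pmf.expectation \<mu> (\<lambda>\<eta>. (diff_op N \<mu> f \<eta>)\<^sup>2)"
  using log_sobolev[of "\<lambda>_. undefined" f] expectation_diff_op_sq_mult[of f "\<lambda>_. 1"]
  by (simp add: Ent_eq_ent)

lemma gibbs_covariance_log_sobolev:
  "Ent \<mu> (\<lambda>\<eta>. exp (f \<eta>)) \<le>
    lsi_const * (\<Sum>i=1..N. measure_pmf.expectation \<mu> (\<lambda>\<eta>.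
      Cov (cond_site N \<mu> i \<eta>) (\<lambda>x. f (\<eta>(i := x))) (\<lambda>x. exp (f (\<eta>(i := x))))))"
proof -
  have "E N (\<lambda>_. undefined) (local_energy i (\<lambda>\<eta>. exp (f \<eta> / 2))) \<le>
      measure_pmf.expectation \<mu> (\<lambda>\<eta>.
        Cov (cond_site N \<mu> i \<eta>) (\<lambda>x. f (\<eta>(i := x))) (\<lambda>x. exp (f (\<eta>(i := x)))))"
    if i: "i \<in> {1..N}" for i
  proof -
    have "measure_pmf.expectation \<mu> (\<lambda>\<eta>.
          Cov (cond_site N \<mu> i \<eta>) (\<lambda>x. f (\<eta>(i := x))) (\<lambda>x. exp (f (\<eta>(i := x))))) =
        measure_pmf.expectation \<mu> (\<lambda>\<eta>.
          (\<Sum>x=1..q. cond_prob i \<eta> x * (f (\<eta>(i := x)) * exp (f (\<eta>(i := x)))))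
          - (\<Sum>x=1..q. cond_prob i \<eta> x * f (\<eta>(i := x)))
            * (\<Sum>x=1..q. cond_prob i \<eta> x * exp (f (\<eta>(i := x)))))"
      using q i by (intro expectation_gibbs_cong) (auto simp: Cov_def expectation_cond_site_eq)
    then show ?thesis
      unfolding expectation_eq_E using mean_local_energy_exp_le_covariance[OF i] by simp
  qed
  then show ?thesis
    unfolding Ent_eq_ent
    by (intro order_trans[OF ent_exp_le] mult_left_mono sum_mono) auto
qed

lemma gibbs_modified_log_sobolev:
  "Ent \<mu> (\<lambda>\<eta>. exp (f \<eta>)) \<le>
    lsi_const / 2 * measure_pmf.expectation \<mu> (\<lambda>\<eta>. (diff_op N \<mu> f \<eta>)\<^sup>2 * exp (f \<eta>))"
proof -
  have "Ent \<mu> (\<lambda>\<eta>. exp (f \<eta>)) \<le>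
      lsi_const * (\<Sum>i=1..N. 1 / 2 * E N (\<lambda>_. undefined) (\<lambda>\<eta>. local_energy i f \<eta> * exp (f \<eta>)))"
    unfolding Ent_eq_ent
    by (intro order_trans[OF ent_exp_le] mult_left_mono sum_mono mean_local_energy_exp_le_energy) auto
  then show ?thesis
    unfolding expectation_diff_op_sq_mult by (simp flip: sum_divide_distrib)
qed

end

theorem theorem5p1:
  fixes q :: nat and \<beta> :: real
  assumes "q \<ge> 3" and "0 < \<beta>" and "2 * real q * \<beta> * exp \<beta> < 1"
  shows "\<exists>\<sigma>1 \<sigma>2 \<sigma>3 :: real. \<sigma>1 > 0 \<and> \<sigma>2 > 0 \<and> \<sigma>3 > 0 \<and>
    (\<forall>(\<alpha> :: real) (s :: nat) (B :: nat \<Rightarrow> nat \<Rightarrow> nat set) (\<gamma> :: nat \<Rightarrow> real).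
       0 < \<alpha> \<and> \<alpha> < \<beta> \<and> block_structure s B \<gamma> \<longrightarrow>
       (\<forall>\<^sub>F N in sequentially. \<forall>f :: (nat \<Rightarrow> nat) \<Rightarrow> real.
          let \<mu> = gibbs q \<beta> \<alpha> s (B N) N in
          Ent \<mu> (\<lambda>\<omega>. (f \<omega>)\<^sup>2) \<le>
            2 * \<sigma>1\<^sup>2 * measure_pmf.expectation \<mu> (\<lambda>\<omega>. (diff_op N \<mu> f \<omega>)\<^sup>2)) \<and>
       (\<forall>\<^sub>F N in sequentially. \<forall>f :: (nat \<Rightarrow> nat) \<Rightarrow> real.
          let \<mu> = gibbs q \<beta> \<alpha> s (B N) N in
          Ent \<mu> (\<lambda>\<omega>. exp (f \<omega>)) \<le>
            \<sigma>2\<^sup>2 * (\<Sum>i=1..N. measure_pmf.expectation \<mu> (\<lambda>\<omega>.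
              Cov (cond_site N \<mu> i \<omega>) (\<lambda>x. f (fun_upd \<omega> i x)) (\<lambda>x. exp (f (fun_upd \<omega> i x)))))) \<and>
       (\<forall>\<^sub>F N in sequentially. \<forall>f :: (nat \<Rightarrow> nat) \<Rightarrow> real.
          let \<mu> = gibbs q \<beta> \<alpha> s (B N) N in
          Ent \<mu> (\<lambda>\<omega>. exp (f \<omega>)) \<le>
            \<sigma>3\<^sup>2 / 2 * measure_pmf.expectation \<mu> (\<lambda>\<omega>. (diff_op N \<mu> f \<omega>)\<^sup>2 * exp (f \<omega>))))"
proof -
  define C where "C = 8 * (real q * exp \<beta>)\<^sup>2 * exp (128 * (real q * exp \<beta>))"
  have C: "0 < C"
    using assms by (simp add: C_def)
  have sq: "2 * (sqrt (C / 2))\<^sup>2 = C" "(sqrt C)\<^sup>2 = C"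
    using C by auto
  show ?thesis
  \<comment> \<open>The constants enter squared, and the first inequality has an extra factor 2. C
    involves only q and \<beta>, so the same roots serve every \<alpha> and every block
    structure.\<close>
  proof (rule exI[of _ "sqrt (C / 2)"], rule exI[of _ "sqrt C"], rule exI[of _ "sqrt C"],
      intro conjI allI impI, unfold sq Let_def)
    fix \<alpha> :: real and s :: nat and B :: "nat \<Rightarrow> nat \<Rightarrow> nat set" and \<gamma> :: "nat \<Rightarrow> real"
    assume "0 < \<alpha> \<and> \<alpha> < \<beta> \<and> block_structure s B \<gamma>"
    then have \<alpha>: "0 < \<alpha>" "\<alpha> < \<beta>"
      by auto
    show "\<forall>\<^sub>F N in sequentially. \<forall>f :: (nat \<Rightarrow> nat) \<Rightarrow> real.
        Ent (gibbs q \<beta> \<alpha> s (B N) N) (\<lambda>\<omega>. (f \<omega>)\<^sup>2) \<le>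
          C * measure_pmf.expectation (gibbs q \<beta> \<alpha> s (B N) N)
            (\<lambda>\<omega>. (diff_op N (gibbs q \<beta> \<alpha> s (B N) N) f \<omega>)\<^sup>2)"
      unfolding C_def using assms \<alpha>
      by (intro eventually_sequentiallyI[of 1] allI gibbs_log_sobolev) auto
    show "\<forall>\<^sub>F N in sequentially. \<forall>f :: (nat \<Rightarrow> nat) \<Rightarrow> real.
        Ent (gibbs q \<beta> \<alpha> s (B N) N) (\<lambda>\<omega>. exp (f \<omega>)) \<le>
          C * (\<Sum>i=1..N. measure_pmf.expectation (gibbs q \<beta> \<alpha> s (B N) N) (\<lambda>\<omega>.
            Cov (cond_site N (gibbs q \<beta> \<alpha> s (B N) N) i \<omega>)
              (\<lambda>x. f (fun_upd \<omega> i x)) (\<lambda>x. exp (f (fun_upd \<omega> i x)))))"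
      unfolding C_def using assms \<alpha>
      by (intro eventually_sequentiallyI[of 1] allI gibbs_covariance_log_sobolev) auto
    show "\<forall>\<^sub>F N in sequentially. \<forall>f :: (nat \<Rightarrow> nat) \<Rightarrow> real.
        Ent (gibbs q \<beta> \<alpha> s (B N) N) (\<lambda>\<omega>. exp (f \<omega>)) \<le>
          C / 2 * measure_pmf.expectation (gibbs q \<beta> \<alpha> s (B N) N)
            (\<lambda>\<omega>. (diff_op N (gibbs q \<beta> \<alpha> s (B N) N) f \<omega>)\<^sup>2 * exp (f \<omega>))"
      unfolding C_def using assms \<alpha>
      by (intro eventually_sequentiallyI[of 1] allI gibbs_modified_log_sobolev) auto
  qed (use C in auto)
qed

end
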